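(* Let $G=P_n \times P_2$ (the ladder graph) and $r\ge 2$. The following are equivalent: (1) $\Sigma_r(G)$ is vertex decomposable; (2) $\Sigma_r(G)$ is shellable; (3) $\Sigma_r(G)$ is Cohen–Macaulay (over a field $\mathbb K$); (4) $G$ is $r$-gap-free; (5) $n \leq r$; (6) the clutter $\mathrm{Con}_r(G)$ is co-chordal.
   Context: $P_n$ is the path on $n$ vertices; $G_1\times G_2$ is the Cartesian product (vertices $(x,y)$, with $(x,y)\sim(a,b)$ iff $x=a$ and $y\sim b$, or $y=b$ and $x\sim a$). $\mathrm{Con}_r(G)$ is the $r$-uniform clutter on $V(G)$ whose circuits are the $r$-subsets $W$ with $G[W]$ connected; $\Sigma_r(G)$ is generated by $V(G)\setminus W$ for such $W$. $G$ is $r$-gap-free if every induced matching of $\mathrm{Con}_r(G)$ (pairwise disjoint circuits $M$ such that the circuits inside $\bigcup M$ are exactly those of $M$) has at most one element. Co-chordal clutter: the complement clutter is chordal, where a $d$-uniform clutter is chordal if it has no circuits or has a $(d-1)$-set $Z$ whose closed neighborhood $Z\cup\{x\notin Z: Z\cup\{x\}\text{ contains a circuit containing }x\}$ is a clique (all $d$-subsets circuits) and such that removing all circuits containing $Z$ leaves a chordal clutter. Vertex decomposable, shellable, Cohen–Macaulay: standard. *)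

theory Defs
  imports Complex_Main "HOL-Library.Ramsey" "HOL-Library.Product_Lexorder"
begin

section \<open>Graphs\<close>

text \<open>A simple graph is a vertex set with a symmetric irreflexive edge relation on it.\<close>

type_synonym 'a sgraph = "'a set \<times> ('a \<times> 'a) set"

definition induced_subgraph :: "'a sgraph \<Rightarrow> 'a set \<Rightarrow> 'a sgraph" where
  "induced_subgraph G W = (fst G \<inter> W, snd G \<inter> (W \<times> W))"

definition connected_graph :: "'a sgraph \<Rightarrow> bool" where
  "connected_graph G \<longleftrightarrow> fst G \<noteq> {} \<and> (\<forall>u\<in>fst G. \<forall>v\<in>fst G. (u, v) \<in> (snd G)\<^sup>*)"

definition path_graph :: "nat \<Rightarrow> nat sgraph" where
  "path_graph n = ({1..n}, {(i, j). i \<in> {1..n} \<and> j \<in> {1..n} \<and> (j = i + 1 \<or> i = j + 1)})"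

definition cartesian_product :: "'a sgraph \<Rightarrow> 'b sgraph \<Rightarrow> ('a \<times> 'b) sgraph" where
  "cartesian_product G H =
     (fst G \<times> fst H,
      {((x, y), (a, b)). (x, y) \<in> fst G \<times> fst H \<and> (a, b) \<in> fst G \<times> fst H \<and>
                         (x = a \<and> (y, b) \<in> snd H \<or> y = b \<and> (x, a) \<in> snd G)})"


section \<open>Uniform clutters\<close>

text \<open>
  A \<open>d\<close>-uniform clutter on \<open>V\<close> is given by its set of circuits, a subset of the set
  \<^term>\<open>nsets V d\<close> of all \<open>d\<close>-element subsets of \<open>V\<close>.
\<close>

definition Con :: "nat \<Rightarrow> 'a sgraph \<Rightarrow> 'a set set" where
  "Con r G = {W \<in> nsets (fst G) r. connected_graph (induced_subgraph G W)}"

definition induced_matching :: "'a set set \<Rightarrow> 'a set set \<Rightarrow> bool" where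
  "induced_matching C M \<longleftrightarrow> pairwise disjnt M \<and> {c \<in> C. c \<subseteq> \<Union>M} = M"

definition gap_free :: "nat \<Rightarrow> 'a sgraph \<Rightarrow> bool" where
  "gap_free r G \<longleftrightarrow> (\<forall>M. induced_matching (Con r G) M \<longrightarrow> finite M \<and> card M \<le> 1)"

definition closed_neighborhood :: "'a set set \<Rightarrow> 'a set \<Rightarrow> 'a set" where
  "closed_neighborhood C Z = Z \<union> {x. x \<notin> Z \<and> (\<exists>c\<in>C. x \<in> c \<and> c \<subseteq> insert x Z)}"

definition clutter_clique :: "nat \<Rightarrow> 'a set set \<Rightarrow> 'a set \<Rightarrow> bool" where
  "clutter_clique d C A \<longleftrightarrow> nsets A d \<subseteq> C"

inductive chordal_clutter :: "'a set \<Rightarrow> nat \<Rightarrow> 'a set set \<Rightarrow> bool" for V d where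
  no_circuits: "chordal_clutter V d {}"
| remove: "Z \<in> nsets V (d - 1) \<Longrightarrow> clutter_clique d C (closed_neighborhood C Z) \<Longrightarrow>
           chordal_clutter V d {c \<in> C. \<not> Z \<subseteq> c} \<Longrightarrow> chordal_clutter V d C"

definition cochordal_clutter :: "'a set \<Rightarrow> nat \<Rightarrow> 'a set set \<Rightarrow> bool" where
  "cochordal_clutter V d C \<longleftrightarrow> chordal_clutter V d (nsets V d - C)"


section \<open>Simplicial complexes\<close>

text \<open>
  A simplicial complex is given by its set of faces, a downward closed set of finite sets.
  The void complex \<open>{}\<close>, which has no faces at all, is a simplicial complex; it is distinct
  from the complex \<open>{{}}\<close> whose only face is the empty one.
\<close>

definition Sigma_complex :: "nat \<Rightarrow> 'a sgraph \<Rightarrow> 'a set set" where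
  "Sigma_complex r G = {F. \<exists>W\<in>Con r G. F \<subseteq> fst G - W}"

definition facets :: "'a set set \<Rightarrow> 'a set set" where
  "facets D = {F \<in> D. \<forall>G\<in>D. F \<subseteq> G \<longrightarrow> G = F}"

definition link :: "'a set set \<Rightarrow> 'a set \<Rightarrow> 'a set set" where
  "link D F = {G \<in> D. G \<inter> F = {} \<and> G \<union> F \<in> D}"

definition deletion :: "'a set set \<Rightarrow> 'a \<Rightarrow> 'a set set" where
  "deletion D x = {G \<in> D. x \<notin> G}"

text \<open>
  The void complex counts as vertex decomposable. As the link and the deletion of a vertex are
  never void, this convention concerns no other complex.
\<close>

inductive vertex_decomposable :: "'a set set \<Rightarrow> bool" where
  void: "vertex_decomposable {}"
| simplex: "finite F \<Longrightarrow> vertex_decomposable (Pow F)"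
| shedding: "{x} \<in> D \<Longrightarrow> facets (deletion D x) \<subseteq> facets D \<Longrightarrow>
             vertex_decomposable (deletion D x) \<Longrightarrow> vertex_decomposable (link D {x}) \<Longrightarrow>
             vertex_decomposable D"

definition dim_face :: "'a set \<Rightarrow> int" where
  "dim_face F = int (card F) - 1"

definition dim_complex :: "'a set set \<Rightarrow> int" where
  "dim_complex D = Max (dim_face ` D)"

definition pure_of_dim :: "int \<Rightarrow> 'a set set \<Rightarrow> bool" where
  "pure_of_dim e D \<longleftrightarrow> (\<forall>F\<in>facets D. dim_face F = e)"

definition shellable :: "'a set set \<Rightarrow> bool" where
  "shellable D \<longleftrightarrow>
     (\<exists>Fs. distinct Fs \<and> set Fs = facets D \<and>
        (\<forall>j<length Fs. j > 0 \<longrightarrow>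
           pure_of_dim (dim_face (Fs ! j) - 1) (Pow (Fs ! j) \<inter> (\<Union>i<j. Pow (Fs ! i)))))"

text \<open>
  Reduced simplicial homology with coefficients in a field. Every face is oriented by the linear
  order on the vertices. The empty face is the only one of dimension \<open>-1\<close>, so the boundary of
  a \<open>0\<close>-chain is its augmentation. The coefficient of a face \<open>T\<close> in the boundary of \<open>f\<close> is
  collected from the faces \<open>insert v T\<close>, in which \<open>v\<close> stands at position
  \<open>card {w \<in> T. w < v}\<close>, counted from \<open>0\<close>.
\<close>

definition chains :: "'a set set \<Rightarrow> int \<Rightarrow> ('a set \<Rightarrow> 'k::field) set" where
  "chains D i = {f. \<forall>F. f F \<noteq> 0 \<longrightarrow> F \<in> D \<and> dim_face F = i}"

definition boundary :: "'a::linorder set set \<Rightarrow> ('a set \<Rightarrow> 'k::field) \<Rightarrow> 'a set \<Rightarrow> 'k" where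
  "boundary D f T = (\<Sum>v \<in> \<Union>D - T. (- 1) ^ card {w \<in> T. w < v} * f (insert v T))"

definition cycles :: "'a::linorder set set \<Rightarrow> int \<Rightarrow> ('a set \<Rightarrow> 'k::field) set" where
  "cycles D i = {f \<in> chains D i. boundary D f = (\<lambda>T. 0)}"

definition boundaries :: "'a::linorder set set \<Rightarrow> int \<Rightarrow> ('a set \<Rightarrow> 'k::field) set" where
  "boundaries D i = boundary D ` chains D (i + 1)"

definition reduced_homology_vanishes :: "'k::field itself \<Rightarrow> 'a::linorder set set \<Rightarrow> int \<Rightarrow> bool" where
  "reduced_homology_vanishes K D i \<longleftrightarrow> cycles D i = (boundaries D i :: ('a set \<Rightarrow> 'k) set)"

text \<open>
  Cohen-Macaulayness over the field \<open>'k\<close> in the homological sense of Reisner, where the link of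
  the empty face is the complex itself.
\<close>

definition cohen_macaulay :: "'k::field itself \<Rightarrow> 'a::linorder set set \<Rightarrow> bool" where
  "cohen_macaulay K D \<longleftrightarrow>
     (\<forall>F\<in>D. \<forall>i < dim_complex (link D F). reduced_homology_vanishes K (link D F) i)"

end

theory Submission
  imports Defs
begin

text \<open>
  If \<open>n \<le> r\<close>, a connected \<open>r\<close>-set avoiding both vertices of the middle column lies on one side of
  it and can only be the whole right half. Splitting the circuits at these two vertices, and then
  growing the sets through a chosen vertex one neighbour at a time, shows that the ideal of
  \<open>Con r G\<close> is vertex splittable: \<open>I = x I\<^sub>1 + I\<^sub>2\<close> with \<open>I\<^sub>2 \<subseteq> I\<^sub>1\<close>, recursively. Such a splitting
  makes \<open>x\<close> a shedding vertex of the dual complex, and lets the eliminations of the complements of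
  \<open>I\<^sub>1\<close> (joined with \<open>x\<close>) and \<open>I\<^sub>2\<close> be concatenated, so that \<open>\<Sigma>\<^sub>r\<close> is vertex decomposable and
  \<open>Con r G\<close> is co-chordal. If \<open>n > r\<close>, there are two disjoint circuits \<open>A\<close> and \<open>B\<close> without an edge
  between them. The link of the complement of \<open>A \<union> B\<close> is then a disjoint union of two simplices
  of positive dimension, so \<open>\<Sigma>\<^sub>r\<close> is neither Cohen-Macaulay nor shellable. Moreover, as long as the
  elimination of the complement of \<open>Con r G\<close> has kept all \<open>r\<close>-subsets of \<open>A \<union> B\<close> but \<open>A\<close> and \<open>B\<close>,
  no \<open>(r - 1)\<close>-subset of \<open>A \<union> B\<close> has a clique as closed neighborhood, so that these \<open>r\<close>-subsets
  are never removed.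
\<close>


section \<open>Vertex splittable families and chordality\<close>

text \<open>
  A family of \<open>d\<close>-sets stands for the squarefree monomial ideal that it generates; the last premise
  of \<open>split\<close> says \<open>I\<^sub>2 \<subseteq> I\<^sub>1\<close>.
\<close>

inductive vertex_splittable :: "'a set set \<Rightarrow> bool" where
  void: "vertex_splittable {}"
| unit: "vertex_splittable {{}}"
| split: "vertex_splittable {W. x \<notin> W \<and> insert x W \<in> C} \<Longrightarrow> vertex_splittable {W \<in> C. x \<notin> W} \<Longrightarrow>
          (\<And>W. W \<in> C \<Longrightarrow> x \<notin> W \<Longrightarrow> \<exists>U. U \<subseteq> W \<and> insert x U \<in> C) \<Longrightarrow> vertex_splittable C"

lemma nsets_iff: "N \<in> nsets A n \<longleftrightarrow> N \<subseteq> A \<and> finite N \<and> card N = n"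
  by (simp add: nsets_def)

lemma nsets_0: "nsets A 0 = {{}}"
  by (auto simp: nsets_def)

lemma insert_link_nsets:
  assumes "C \<subseteq> nsets V d"
  shows "{W. x \<notin> W \<and> insert x W \<in> C} \<subseteq> nsets (V - {x}) (d - 1)"
proof
  fix W assume "W \<in> {W. x \<notin> W \<and> insert x W \<in> C}"
  then have W: "x \<notin> W" and "insert x W \<in> nsets V d" using assms by auto
  then show "W \<in> nsets (V - {x}) (d - 1)" by (auto simp: nsets_iff)
qed

lemma avoiding_nsets:
  assumes "C \<subseteq> nsets V d"
  shows "{W \<in> C. x \<notin> W} \<subseteq> nsets (V - {x}) d"
  using assms by (auto simp: nsets_iff subset_iff)

section \<open>Dual complexes and vertex decomposability\<close>

text \<open>If the members of \<open>C\<close> are subsets of \<open>V\<close>, this is the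
  Alexander dual of the complex of those subsets of \<open>V\<close> that contain no member of
  \<open>C\<close>.\<close>

definition dual_complex :: "'a set \<Rightarrow> 'a set set \<Rightarrow> 'a set set" where
  "dual_complex V C = {F. \<exists>W\<in>C. F \<subseteq> V - W}"

lemma Sigma_complex_eq_dual: "Sigma_complex r G = dual_complex (fst G) (Con r G)"
  by (simp add: Sigma_complex_def dual_complex_def)

text \<open>Distinct sets of the same size \<open>d\<close> are incomparable, and so are their
  complements.\<close>

lemma facets_dual_complex:
  assumes "C \<subseteq> nsets V d"
  shows "facets (dual_complex V C) = (\<lambda>W. V - W) ` C"
proof
  show "facets (dual_complex V C) \<subseteq> (\<lambda>W. V - W) ` C"
  proof
    fix F assume F: "F \<in> facets (dual_complex V C)"
    then obtain W where W: "W \<in> C" "F \<subseteq> V - W" by (auto simp: facets_def dual_complex_def)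
    moreover have "V - W \<in> dual_complex V C" using W by (auto simp: dual_complex_def)
    ultimately show "F \<in> (\<lambda>W. V - W) ` C" using F by (auto simp: facets_def)
  qed
next
  show "(\<lambda>W. V - W) ` C \<subseteq> facets (dual_complex V C)"
  proof
    fix F assume "F \<in> (\<lambda>W. V - W) ` C"
    then obtain W where W: "W \<in> C" "F = V - W" by auto
    have "G = F" if "G \<in> dual_complex V C" "F \<subseteq> G" for G
    proof -
      from that obtain U where U: "U \<in> C" "G \<subseteq> V - U" by (auto simp: dual_complex_def)
      have WU: "W \<in> nsets V d" "U \<in> nsets V d" using W U assms by auto
      then have "U \<subseteq> W" using W U \<open>F \<subseteq> G\<close> by (auto simp: nsets_iff)
      then have "U = W" using WU by (simp add: nsets_iff card_subset_eq)
      then show "G = F" using U W that by auto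
    qed
    then show "F \<in> facets (dual_complex V C)"
      using W by (auto simp: facets_def dual_complex_def)
  qed
qed

text \<open>Over \<open>V - {x}\<close>, the deletion of \<open>x\<close> is dual to
  \<open>?C1\<close> and the link of \<open>x\<close> is dual to \<open>?C2\<close>. The containment
  premise of \<open>split\<close> lets the deletion absorb the complements of the members that avoid
  \<open>x\<close>.\<close>

lemma vertex_splittable_imp_vertex_decomposable:
  assumes "vertex_splittable C" "finite V" "C \<subseteq> nsets V d"
  shows "vertex_decomposable (dual_complex V C)"
  using assms
proof (induction C arbitrary: V d rule: vertex_splittable.induct)
  case void
  then show ?case by (simp add: dual_complex_def vertex_decomposable.void)
next
  case unit
  then have "dual_complex V {{}} = Pow V" by (auto simp: dual_complex_def)
  then show ?case using unit vertex_decomposable.simplex by metis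
next
  case (split x C)
  let ?D = "dual_complex V C" and ?C1 = "{W. x \<notin> W \<and> insert x W \<in> C}" and ?C2 = "{W \<in> C. x \<notin> W}"
  have del: "deletion ?D x = dual_complex (V - {x}) ?C1"
  proof (rule set_eqI, rule iffI)
    fix F assume "F \<in> deletion ?D x"
    then obtain W where W: "W \<in> C" "F \<subseteq> V - W" "x \<notin> F" by (auto simp: deletion_def dual_complex_def)
    obtain U where U: "U \<in> ?C1" "U \<subseteq> W"
    proof (cases "x \<in> W")
      case True
      then have "W - {x} \<in> ?C1" using W by (simp add: insert_absorb)
      then show ?thesis using that by blast
    next
      case False
      then show ?thesis using split.hyps(3)[OF W(1)] that by blast
    qed
    then show "F \<in> dual_complex (V - {x}) ?C1" using W by (auto simp: dual_complex_def)
  next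
    fix F assume "F \<in> dual_complex (V - {x}) ?C1"
    then obtain U where "x \<notin> U" "insert x U \<in> C" "F \<subseteq> V - {x} - U" by (auto simp: dual_complex_def)
    then show "F \<in> deletion ?D x" unfolding deletion_def dual_complex_def by blast
  qed
  have vd_del: "vertex_decomposable (deletion ?D x)"
    unfolding del by (rule split.IH(1)[OF _ insert_link_nsets[OF split.prems(2)]]) (use split.prems in simp)
  show ?case
  \<comment> \<open>If no member avoids \<open>x\<close>, then \<open>{x}\<close> is not a face and
    cannot be shed; the complex then equals its own deletion.\<close>
  proof (cases "?C2 = {}")
    case True
    then have "?D = deletion ?D x" by (auto simp: deletion_def dual_complex_def)
    then show ?thesis using vd_del by simp
  next
    case False
    then obtain W where W: "W \<in> C" "x \<notin> W" by auto
    then obtain U where "insert x U \<in> C" using split.hyps(3) by blast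
    then have xV: "x \<in> V" using split.prems by (auto simp: nsets_iff)
    show ?thesis
    proof (rule vertex_decomposable.shedding)
      show "{x} \<in> ?D" using W xV by (auto simp: dual_complex_def)
      have "facets (deletion ?D x) = (\<lambda>W. V - {x} - W) ` ?C1"
        unfolding del by (rule facets_dual_complex[OF insert_link_nsets[OF split.prems(2)]])
      also have "\<dots> \<subseteq> (\<lambda>W. V - W) ` C"
      proof
        fix F assume "F \<in> (\<lambda>W. V - {x} - W) ` ?C1"
        then obtain U where "insert x U \<in> C" "F = V - insert x U" by auto
        then show "F \<in> (\<lambda>W. V - W) ` C" by blast
      qed
      also have "\<dots> = facets ?D" using facets_dual_complex[OF split.prems(2)] by simp
      finally show "facets (deletion ?D x) \<subseteq> facets ?D" .
      show "vertex_decomposable (deletion ?D x)" by (rule vd_del)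
      have "link ?D {x} = dual_complex (V - {x}) ?C2"
        using xV unfolding link_def dual_complex_def by blast
      moreover have "vertex_decomposable (dual_complex (V - {x}) ?C2)"
        by (rule split.IH(2)[OF _ avoiding_nsets[OF split.prems(2)]]) (use split.prems in simp)
      ultimately show "vertex_decomposable (link ?D {x})" by simp
    qed
  qed
qed

section \<open>Elimination orders and co-chordality\<close>

lemma chordal_clutter_mono:
  assumes "chordal_clutter V d C" "V \<subseteq> V'"
  shows "chordal_clutter V' d C"
  using assms
proof (induction rule: chordal_clutter.induct)
  case no_circuits
  then show ?case by (simp add: chordal_clutter.no_circuits)
next
  case (remove Z C)
  have "Z \<in> nsets V' (d - 1)" using remove.hyps(1) remove.prems unfolding nsets_iff by blast
  then show ?case using remove.hyps(2) remove.IH[OF remove.prems] by (rule chordal_clutter.remove)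
qed

lemma closed_neighborhood_insert:
  assumes "x \<notin> Z" "\<And>c. c \<in> C1 \<Longrightarrow> x \<notin> c" "\<And>c. c \<in> C2 \<Longrightarrow> x \<notin> c"
    and "\<And>c. c \<in> C2 \<Longrightarrow> finite c \<and> card Z + 2 = card c" "finite Z"
  shows "closed_neighborhood (insert x ` C1 \<union> C2) (insert x Z) \<subseteq> insert x (closed_neighborhood C1 Z)"
proof
  fix y assume y: "y \<in> closed_neighborhood (insert x ` C1 \<union> C2) (insert x Z)"
  show "y \<in> insert x (closed_neighborhood C1 Z)"
  proof (cases "y \<in> insert x Z")
    case True
    then show ?thesis by (auto simp: closed_neighborhood_def)
  next
    case False
    then obtain c where c: "c \<in> insert x ` C1 \<union> C2" "y \<in> c" "c \<subseteq> insert y (insert x Z)"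
      using y by (auto simp: closed_neighborhood_def)
    have "c \<notin> C2"
    proof
      assume c2: "c \<in> C2"
      then have "c \<subseteq> insert y Z" using c assms(3) by blast
      then have "card c \<le> card (insert y Z)" using assms(5) by (simp add: card_mono)
      then show False using assms(4)[OF c2] assms(5)
        by (simp add: card_insert_if split: if_splits)
    qed
    then obtain e where e: "e \<in> C1" "c = insert x e" using c by auto
    then have "y \<in> e" "e \<subseteq> insert y Z" using c False assms(2) by blast+
    then show ?thesis using e False unfolding closed_neighborhood_def by blast
  qed
qed

text \<open>
  The elimination order of \<open>C1\<close> is followed first, with \<open>x\<close> added to every set. A clique met on
  the way also contains sets without \<open>x\<close>; they lie in \<open>C2\<close> because all their \<open>d\<close>-subsets lie in \<open>C1\<close>.
\<close>

lemma chordal_clutter_insert: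
  assumes "chordal_clutter V d C1" "d \<ge> 1" "C1 \<subseteq> nsets V d" "C2 \<subseteq> nsets V (Suc d)" "x \<notin> V"
    and "\<And>W. W \<in> nsets V (Suc d) \<Longrightarrow> nsets W d \<subseteq> C1 \<Longrightarrow> W \<in> C2"
    and "chordal_clutter V (Suc d) C2"
  shows "chordal_clutter (insert x V) (Suc d) (insert x ` C1 \<union> C2)"
  using assms
proof (induction rule: chordal_clutter.induct)
  case no_circuits
  then show ?case by (auto intro: chordal_clutter_mono)
next
  case (remove Z C)
  have Z: "Z \<subseteq> V" "finite Z" "card Z = d - 1" "x \<notin> Z" using remove.hyps(1) remove.prems(4) by (auto simp: nsets_iff)
  have xC: "x \<notin> c" if "c \<in> C" for c using remove.prems(2,4) that nsets_iff by blast
  have C2: "x \<notin> c \<and> finite c \<and> card c = Suc d" if "c \<in> C2" for c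
    using subsetD[OF remove.prems(3) that] remove.prems(4) unfolding nsets_iff by blast
  have NV: "closed_neighborhood C Z \<subseteq> V"
  proof -
    have "\<Union>C \<subseteq> V" using remove.prems(2) unfolding nsets_def by blast
    then show ?thesis using Z(1) by (auto simp: closed_neighborhood_def)
  qed
  have N: "closed_neighborhood (insert x ` C \<union> C2) (insert x Z) \<subseteq> insert x (closed_neighborhood C Z)"
    by (rule closed_neighborhood_insert) (use Z xC C2 \<open>d \<ge> 1\<close> in auto)
  show ?case
  proof (rule chordal_clutter.remove)
    show "insert x Z \<in> nsets (insert x V) (Suc d - 1)"
      using Z \<open>d \<ge> 1\<close> by (auto simp: nsets_iff)
    show "clutter_clique (Suc d) (insert x ` C \<union> C2)
        (closed_neighborhood (insert x ` C \<union> C2) (insert x Z))"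
      unfolding clutter_clique_def
    proof
      fix W assume "W \<in> nsets (closed_neighborhood (insert x ` C \<union> C2) (insert x Z)) (Suc d)"
      then have W: "W \<subseteq> insert x (closed_neighborhood C Z)" "finite W" "card W = Suc d"
        using N by (auto simp: nsets_iff)
      show "W \<in> insert x ` C \<union> C2"
      proof (cases "x \<in> W")
        case True
        then have "W - {x} \<in> nsets (closed_neighborhood C Z) d" using W by (auto simp: nsets_iff)
        then have "W - {x} \<in> C" using remove.hyps by (auto simp: clutter_clique_def)
        then have "insert x (W - {x}) \<in> insert x ` C" by blast
        then show ?thesis using True by (simp add: insert_absorb)
      next
        case False
        then have W': "W \<subseteq> closed_neighborhood C Z" using W by auto
        then have "nsets W d \<subseteq> C" using remove.hyps nsets_mono unfolding clutter_clique_def by blast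
        moreover have "W \<in> nsets V (Suc d)" using W W' NV by (auto simp: nsets_iff)
        ultimately show ?thesis using remove.prems(5) by blast
      qed
    qed
    have "{c \<in> insert x ` C \<union> C2. \<not> insert x Z \<subseteq> c} = insert x ` {c \<in> C. \<not> Z \<subseteq> c} \<union> C2"
      using Z xC C2 by (auto simp: subset_insert)
    moreover have "chordal_clutter (insert x V) (Suc d) (insert x ` {c \<in> C. \<not> Z \<subseteq> c} \<union> C2)"
    proof (rule remove.IH)
      show "{c \<in> C. \<not> Z \<subseteq> c} \<subseteq> nsets V d" using remove.prems by auto
      fix W assume W: "W \<in> nsets V (Suc d)" "nsets W d \<subseteq> {c \<in> C. \<not> Z \<subseteq> c}"
      then show "W \<in> C2" using remove.prems(5)[OF W(1)] by auto
    qed (use remove.prems in auto)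
    ultimately show "chordal_clutter (insert x V) (Suc d) {c \<in> insert x ` C \<union> C2. \<not> insert x Z \<subseteq> c}"
      by simp
  qed
qed

lemma nsets_insert:
  assumes "x \<notin> V"
  shows "nsets (insert x V) (Suc d) = insert x ` nsets V d \<union> nsets V (Suc d)"
proof (rule set_eqI, rule iffI)
  fix W assume W: "W \<in> nsets (insert x V) (Suc d)"
  show "W \<in> insert x ` nsets V d \<union> nsets V (Suc d)"
  proof (cases "x \<in> W")
    case True
    then have "W - {x} \<in> nsets V d" "insert x (W - {x}) = W" using W by (auto simp: nsets_iff)
    then show ?thesis by blast
  next
    case False
    then show ?thesis using W by (auto simp: nsets_iff)
  qed
next
  fix W assume "W \<in> insert x ` nsets V d \<union> nsets V (Suc d)"
  then show "W \<in> nsets (insert x V) (Suc d)"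
  proof
    assume "W \<in> insert x ` nsets V d"
    then obtain U where "U \<in> nsets V d" "W = insert x U" by auto
    moreover from this have "x \<notin> U" using assms by (auto simp: nsets_iff)
    ultimately show ?thesis by (auto simp: nsets_iff)
  qed (auto simp: nsets_iff)
qed

text \<open>For \<open>d = 0\<close> the truncated difference \<open>d - 1\<close> is again 0, so
  the empty set qualifies as \<open>Z\<close>.\<close>

lemma chordal_clutter_unit: "chordal_clutter V 0 {{}}"
proof (rule chordal_clutter.remove[where Z = "{}"])
  show "clutter_clique 0 {{}} (closed_neighborhood {{}} {})"
    by (auto simp: clutter_clique_def nsets_iff)
qed (auto simp: nsets_iff chordal_clutter.no_circuits)

lemma chordal_clutter_nsets_1: "chordal_clutter V 1 (nsets V 1)"
proof (rule chordal_clutter.remove[where Z = "{}"])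
  have "closed_neighborhood (nsets V 1) {} \<subseteq> V"
    by (auto simp: closed_neighborhood_def nsets_iff)
  then show "clutter_clique 1 (nsets V 1) (closed_neighborhood (nsets V 1) {})"
    unfolding clutter_clique_def by (rule nsets_mono)
qed (auto simp: nsets_iff chordal_clutter.no_circuits)

text \<open>The sets through a vertex and those avoiding it are the two families of
  \<open>chordal_clutter_insert\<close>. That lemma asks for a positive smaller size, so sizes 0 and
  1 are handled directly.\<close>

lemma chordal_clutter_nsets:
  assumes "finite V"
  shows "chordal_clutter V d (nsets V d)"
  using assms
proof (induction V arbitrary: d rule: finite_induct)
  case empty
  show ?case
  proof (cases d)
    case 0
    then show ?thesis using chordal_clutter_unit by (simp add: nsets_0)
  next
    case (Suc e)
    then have "nsets {} d = ({} :: 'a set set)" by (auto simp: nsets_iff)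
    then show ?thesis by (simp add: chordal_clutter.no_circuits)
  qed
next
  case (insert x V)
  consider "d = 0" | "d = 1" | e where "d = Suc e" "e \<ge> 1"
    by (metis One_nat_def Suc_leI not0_implies_Suc not_gr_zero)
  then show ?case
  proof cases
    case 1
    then show ?thesis using chordal_clutter_unit by (simp add: nsets_0)
  next
    case 2
    then show ?thesis using chordal_clutter_nsets_1 by simp
  next
    case 3
    have "chordal_clutter (insert x V) (Suc e) (insert x ` nsets V e \<union> nsets V (Suc e))"
      by (rule chordal_clutter_insert) (use insert 3 in auto)
    then show ?thesis using 3 nsets_insert[OF insert.hyps(2)] by metis
  qed
qed

text \<open>Under complementation, the containment premise of \<open>split\<close> becomes the
  closure condition of \<open>chordal_clutter_insert\<close>: a set whose \<open>e\<close>-subsets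
  all lie outside \<open>?C1\<close> lies outside \<open>?C2\<close>.\<close>

lemma vertex_splittable_imp_cochordal:
  assumes "vertex_splittable C" "finite V" "C \<subseteq> nsets V d"
  shows "cochordal_clutter V d C"
  using assms
proof (induction C arbitrary: V d rule: vertex_splittable.induct)
  case void
  then show ?case by (simp add: cochordal_clutter_def chordal_clutter_nsets)
next
  case unit
  then have "d = 0" by (auto simp: nsets_iff)
  then show ?case by (simp add: cochordal_clutter_def nsets_0 chordal_clutter.no_circuits)
next
  case (split x C)
  let ?C1 = "{W. x \<notin> W \<and> insert x W \<in> C}" and ?C2 = "{W \<in> C. x \<notin> W}"
  show ?case
  proof (cases "C = {}")
    case True
    then show ?thesis using split.prems by (simp add: cochordal_clutter_def chordal_clutter_nsets)
  next
    case False
    then obtain U where U: "U \<in> ?C1"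
    proof -
      from False obtain W where W: "W \<in> C" by auto
      show ?thesis
      proof (cases "x \<in> W")
        case True
        then have "W - {x} \<in> ?C1" using W by (simp add: insert_absorb)
        then show ?thesis using that by blast
      next
        case False
        then show ?thesis using split.hyps(3)[OF W] that by blast
      qed
    qed
    then have xU: "insert x U \<in> nsets V d" "x \<notin> U" using split.prems by auto
    define V' where "V' = V - {x}"
    have V: "V = insert x V'" "x \<notin> V'" "finite V'" using xU split.prems by (auto simp: V'_def nsets_iff)
    obtain e where d: "d = Suc e" using xU by (auto simp: nsets_iff)
    have C1: "?C1 \<subseteq> nsets V' e" using insert_link_nsets[OF split.prems(2), of x] d by (simp add: V'_def)
    have C2: "?C2 \<subseteq> nsets V' (Suc e)" using avoiding_nsets[OF split.prems(2), of x] d by (simp add: V'_def)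
    have ch1: "chordal_clutter V' e (nsets V' e - ?C1)" and ch2: "chordal_clutter V' (Suc e) (nsets V' (Suc e) - ?C2)"
      using split.IH(1)[OF V(3) C1] split.IH(2)[OF V(3) C2] by (simp_all add: cochordal_clutter_def)
    have eq: "nsets V d - C = insert x ` (nsets V' e - ?C1) \<union> (nsets V' (Suc e) - ?C2)"
    proof -
      have "insert x W \<notin> nsets V' (Suc e)" for W using V by (auto simp: nsets_iff)
      moreover have "x \<notin> W" if "W \<in> nsets V' k" for W k using V that by (auto simp: nsets_iff)
      ultimately show ?thesis unfolding d V(1) nsets_insert[OF V(2)] by blast
    qed
    have "chordal_clutter (insert x V') (Suc e) (insert x ` (nsets V' e - ?C1) \<union> (nsets V' (Suc e) - ?C2))"
    \<comment> \<open>For \<open>e = 0\<close> the family \<open>?C1\<close> consists of the empty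
      set alone, so the complement has no circuit through \<open>x\<close> and \<open>ch2\<close>
      suffices.\<close>
    proof (cases "e = 0")
      case True
      then have "U = {}" using U C1 by (auto simp: nsets_0)
      then have "nsets V' e - ?C1 = {}" using U True by (simp add: nsets_0)
      then show ?thesis using chordal_clutter_mono[OF ch2, of "insert x V'"] by (metis Un_empty_left image_empty subset_insertI)
    next
      case False
      show ?thesis
      proof (rule chordal_clutter_insert[OF ch1 _ _ _ _ _ ch2])
        fix W assume W: "W \<in> nsets V' (Suc e)" "nsets W e \<subseteq> nsets V' e - ?C1"
        have "W \<notin> ?C2"
        proof
          assume "W \<in> ?C2"
          then obtain T where T: "T \<subseteq> W" "insert x T \<in> C" using split.hyps(3) by blast
          then have "T \<in> ?C1" using \<open>W \<in> ?C2\<close> by auto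
          moreover from this have "T \<in> nsets W e" using C1 T by (auto simp: nsets_iff)
          ultimately show False using W by auto
        qed
        then show "W \<in> nsets V' (Suc e) - ?C2" using W by auto
      qed (use False V in auto)
    qed
    then show ?thesis unfolding cochordal_clutter_def eq using V d by simp
  qed
qed

text \<open>Removing the circuits over a \<open>Z\<close> that is not contained in
  \<open>A Un B\<close> touches no subset of \<open>A Un B\<close>. For any other \<open>Z\<close>
  the closed neighborhood contains all of \<open>A\<close> or all of \<open>B\<close>, which is not
  a circuit.\<close>

lemma not_chordal_if_two_missing:
  assumes "chordal_clutter V d C" "d \<ge> 2" "A \<in> nsets V d" "B \<in> nsets V d" "A \<inter> B = {}"
    and "A \<notin> C" "B \<notin> C" "nsets (A \<union> B) d - {A, B} \<subseteq> C"
  shows False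
  using assms
proof (induction rule: chordal_clutter.induct)
  case no_circuits
  have A: "finite A" "card A = d" "finite B" "card B = d" using no_circuits by (auto simp: nsets_iff)
  then obtain a b where ab: "a \<in> A" "b \<in> B" using \<open>d \<ge> 2\<close> by fastforce
  obtain a' where a': "a' \<in> A" "a' \<noteq> a"
  proof -
    have "card (A - {a}) \<noteq> 0" using A ab \<open>d \<ge> 2\<close> by simp
    then show ?thesis using that by (metis Diff_iff card.empty all_not_in_conv singletonI)
  qed
  \<comment> \<open>Exchanging one element of \<open>A\<close> for one of \<open>B\<close> gives a
    third \<open>d\<close>-set, because \<open>d\<close> is at least 2.\<close>
  have b: "b \<notin> A" using ab no_circuits by blast
  let ?W = "insert b (A - {a})"
  have "?W \<in> nsets (A \<union> B) d" using A ab b \<open>d \<ge> 2\<close> by (auto simp: nsets_iff)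
  moreover have "?W \<noteq> A" "?W \<noteq> B" using ab a' b no_circuits by blast+
  ultimately show False using no_circuits by blast
next
  case (remove Z C)
  have A: "finite A" "card A = d" "finite B" "card B = d"
    using remove.prems(2,3) by (auto simp: nsets_iff)
  have Z: "finite Z" "card Z = d - 1" using remove.hyps(1) unfolding nsets_iff by blast+
  show False
  proof (cases "Z \<subseteq> A \<union> B")
    case False
    then have "nsets (A \<union> B) d - {A, B} \<subseteq> {c \<in> C. \<not> Z \<subseteq> c}"
    proof -
      have "\<not> Z \<subseteq> c" if "c \<in> nsets (A \<union> B) d" for c
        using False subset_trans[of Z c "A \<union> B"] that unfolding nsets_iff by metis
      then show ?thesis using remove.prems(7) by blast
    qed
    then show False using remove.IH remove.prems by blast
  next
    case True
    have N: "y \<in> closed_neighborhood C Z" if "y \<in> A \<union> B" "insert y Z \<noteq> A" "insert y Z \<noteq> B" for y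
    proof (cases "y \<in> Z")
      case False
      then have "insert y Z \<in> nsets (A \<union> B) d"
        using Z True that \<open>d \<ge> 2\<close> by (auto simp: nsets_iff)
      then show ?thesis using that remove.prems(7) False unfolding closed_neighborhood_def by blast
    qed (auto simp: closed_neighborhood_def)
    have cl: "X \<in> C" if "X \<subseteq> closed_neighborhood C Z" "finite X" "card X = d" for X
      using remove.hyps(2) that by (auto simp: clutter_clique_def nsets_iff)
    have ne: "Z \<noteq> {}" using Z \<open>d \<ge> 2\<close> by auto
    \<comment> \<open>A nonempty \<open>Z\<close> inside \<open>A\<close> reaches all of
      \<open>B\<close>, and one inside \<open>B\<close> reaches all of \<open>A\<close>. If
      \<open>Z\<close> lies in neither, no extension of it is \<open>A\<close> or \<open>B\<close>,
      so it reaches all of \<open>A\<close> as well.\<close>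
    consider "Z \<subseteq> A" | "Z \<subseteq> B" | "\<not> Z \<subseteq> A" "\<not> Z \<subseteq> B" by blast
    then show False
    proof cases
      case 1
      have "B \<subseteq> closed_neighborhood C Z"
      proof
        fix b assume b: "b \<in> B"
        have "insert b Z \<noteq> A" "insert b Z \<noteq> B" using 1 ne b remove.prems(4) by blast+
        then show "b \<in> closed_neighborhood C Z" using N b by blast
      qed
      then show False using cl A remove.prems by blast
    next
      case 2
      have "A \<subseteq> closed_neighborhood C Z"
      proof
        fix b assume b: "b \<in> A"
        have "insert b Z \<noteq> A" "insert b Z \<noteq> B" using 2 ne b remove.prems(4) by blast+
        then show "b \<in> closed_neighborhood C Z" using N b by blast
      qed
      then show False using cl A remove.prems by blast
    next
      case 3
      have "A \<subseteq> closed_neighborhood C Z"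
      proof
        fix b assume b: "b \<in> A"
        have "insert b Z \<noteq> A" "insert b Z \<noteq> B" using 3 by blast+
        then show "b \<in> closed_neighborhood C Z" using N b by blast
      qed
      then show False using cl A remove.prems by blast
    qed
  qed
qed

section \<open>Gaps, that is, induced matchings with two members\<close>

text \<open>Disjointness makes \<open>A\<close> and \<open>B\<close> distinct once the members of
  \<open>C\<close> are nonempty.\<close>

definition gap :: "'a set set \<Rightarrow> 'a set \<Rightarrow> 'a set \<Rightarrow> bool" where
  "gap C A B \<longleftrightarrow> A \<in> C \<and> B \<in> C \<and> A \<inter> B = {} \<and> (\<forall>W\<in>C. W \<subseteq> A \<union> B \<longrightarrow> W = A \<or> W = B)"

lemma gap_imp_not_cochordal:
  assumes "gap C A B" "C \<subseteq> nsets V d" "d \<ge> 2"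
  shows "\<not> cochordal_clutter V d C"
proof
  assume "cochordal_clutter V d C"
  then have "chordal_clutter V d (nsets V d - C)" by (simp add: cochordal_clutter_def)
  moreover have "A \<in> nsets V d" "B \<in> nsets V d" using assms(1,2) unfolding gap_def by blast+
  moreover from this have "nsets (A \<union> B) d - {A, B} \<subseteq> nsets V d - C"
  proof -
    have "W \<notin> C" if "W \<in> nsets (A \<union> B) d" "W \<noteq> A" "W \<noteq> B" for W
      using assms(1) that unfolding gap_def nsets_iff by blast
    moreover have "nsets (A \<union> B) d \<subseteq> nsets V d"
      by (rule nsets_mono) (use \<open>A \<in> nsets V d\<close> \<open>B \<in> nsets V d\<close> in \<open>simp add: nsets_iff\<close>)
    ultimately show ?thesis by blast
  qed
  ultimately show False
    using assms(1,3) not_chordal_if_two_missing[of V d "nsets V d - C" A B] by (simp add: gap_def)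
qed

lemma Con_nsets: "Con r G \<subseteq> nsets (fst G) r"
  by (auto simp: Con_def)

text \<open>Any two members of an induced matching form a gap: a circuit inside their union belongs
  to the matching, is nonempty since \<open>r\<close> is at least 1, and therefore meets one of the
  two and coincides with it.\<close>

lemma gap_free_iff:
  assumes "r \<ge> 1"
  shows "gap_free r G \<longleftrightarrow> (\<nexists>A B. gap (Con r G) A B)"
proof
  assume gf: "gap_free r G"
  show "\<nexists>A B. gap (Con r G) A B"
  proof
    assume "\<exists>A B. gap (Con r G) A B"
    then obtain A B where g: "gap (Con r G) A B" by auto
    have "A \<noteq> {}" using g Con_nsets[of r G] assms by (auto simp: gap_def nsets_iff)
    then have "A \<noteq> B" using g by (auto simp: gap_def)
    moreover have "induced_matching (Con r G) {A, B}"
      unfolding induced_matching_def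
    proof
      show "pairwise disjnt {A, B}" using g by (simp add: gap_def pairwise_insert disjnt_def Int_commute)
      show "{c \<in> Con r G. c \<subseteq> \<Union>{A, B}} = {A, B}" using g unfolding gap_def by auto
    qed
    ultimately have "card {A, B} \<le> 1" using gf unfolding gap_free_def by blast
    then show False using \<open>A \<noteq> B\<close> by simp
  qed
next
  assume ng: "\<nexists>A B. gap (Con r G) A B"
  show "gap_free r G"
    unfolding gap_free_def
  proof (intro allI impI)
    fix M assume M: "induced_matching (Con r G) M"
    have "A = B" if AB: "A \<in> M" "B \<in> M" for A B
    proof (rule ccontr)
      assume "A \<noteq> B"
      have dj: "X = Y" if "X \<in> M" "Y \<in> M" "X \<inter> Y \<noteq> {}" for X Y
        using M that unfolding induced_matching_def pairwise_def disjnt_def by metis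
      have "M \<subseteq> Con r G" using M by (auto simp: induced_matching_def)
      moreover have "W = A \<or> W = B" if W: "W \<in> Con r G" "W \<subseteq> A \<union> B" for W
      proof -
        have "W \<in> M" using M AB W unfolding induced_matching_def by blast
        have "card W = r" using W(1) Con_nsets[of r G] nsets_iff by blast
        then have "W \<noteq> {}" using assms by auto
        then have "W \<inter> A \<noteq> {} \<or> W \<inter> B \<noteq> {}" using W(2) by blast
        then show ?thesis using dj[OF \<open>W \<in> M\<close>] AB by metis
      qed
      ultimately have "gap (Con r G) A B" using AB \<open>A \<noteq> B\<close> dj unfolding gap_def by blast
      then show False using ng by blast
    qed
    then have "M = {} \<or> (\<exists>A. M = {A})" by blast
    then show "finite M \<and> card M \<le> 1" by auto
  qed
qed


section \<open>Shellability\<close>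

definition simplicial_complex :: "'a set set \<Rightarrow> bool" where
  "simplicial_complex D \<longleftrightarrow> finite D \<and> (\<forall>F\<in>D. finite F) \<and> (\<forall>F\<in>D. \<forall>G\<subseteq>F. G \<in> D)"

lemma simplicial_complexD:
  assumes "simplicial_complex D"
  shows "finite D" "F \<in> D \<Longrightarrow> finite F" "F \<in> D \<Longrightarrow> G \<subseteq> F \<Longrightarrow> G \<in> D"
  using assms by (auto simp: simplicial_complex_def)

lemma simplicial_complex_deletion: "simplicial_complex D \<Longrightarrow> simplicial_complex (deletion D x)"
  by (auto simp: simplicial_complex_def deletion_def)

lemma simplicial_complex_link:
  assumes "simplicial_complex D"
  shows "simplicial_complex (link D F)"
proof -
  have "H \<in> link D F" if "G \<in> link D F" "H \<subseteq> G" for G H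
  proof -
    have "H \<union> F \<subseteq> G \<union> F" "G \<union> F \<in> D" "G \<in> D" "G \<inter> F = {}" using that by (auto simp: link_def)
    then have "H \<union> F \<in> D" "H \<in> D" "H \<inter> F = {}" using simplicial_complexD(3)[OF assms] that by blast+
    then show ?thesis by (simp add: link_def)
  qed
  moreover have "link D F \<subseteq> D" by (auto simp: link_def)
  ultimately show ?thesis
    using simplicial_complexD(1,2)[OF assms] unfolding simplicial_complex_def
    by (meson finite_subset subsetD)
qed

lemma simplicial_complex_dual:
  assumes "finite V"
  shows "simplicial_complex (dual_complex V C)"
proof -
  have "dual_complex V C \<subseteq> Pow V" by (auto simp: dual_complex_def)
  then have "finite (dual_complex V C)" "\<forall>F\<in>dual_complex V C. finite F"
    using assms by (auto intro: finite_subset)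
  then show ?thesis unfolding simplicial_complex_def dual_complex_def by blast
qed

lemma face_in_facet:
  assumes "finite D" "F \<in> D"
  obtains G where "G \<in> facets D" "F \<subseteq> G"
  using finite_has_maximal2[OF assms] unfolding facets_def by auto

text \<open>The shelling condition for appending the facet \<open>F\<close> after the facets in
  \<open>S\<close>, phrased by pairwise intersections instead of the facets of the intersection
  complex. It is vacuous for the first facet.\<close>

definition shelling_step :: "'a set set \<Rightarrow> 'a set \<Rightarrow> bool" where
  "shelling_step S F \<longleftrightarrow> (\<forall>A\<in>S. \<exists>B\<in>S. A \<inter> F \<subseteq> B \<and> card (B \<inter> F) + 1 = card F)"

text \<open>Every facet of the intersection complex has the form \<open>B Int F\<close> with
  \<open>B\<close> in \<open>S\<close>, so purity says that each intersection lies below one of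
  codimension one.\<close>

lemma pure_of_dim_iff_shelling_step:
  assumes "finite F" "F \<noteq> {}" "\<And>A. A \<in> S \<Longrightarrow> \<not> F \<subseteq> A"
  shows "pure_of_dim (dim_face F - 1) (Pow F \<inter> (\<Union>A\<in>S. Pow A)) \<longleftrightarrow> shelling_step S F"
proof
  let ?Q = "Pow F \<inter> (\<Union>A\<in>S. Pow A)"
  assume pure: "pure_of_dim (dim_face F - 1) ?Q"
  show "shelling_step S F"
    unfolding shelling_step_def
  proof
    fix A assume A: "A \<in> S"
    have "finite ?Q" using assms(1) by simp
    moreover have "A \<inter> F \<in> ?Q" using A by auto
    ultimately obtain H where H: "H \<in> facets ?Q" "A \<inter> F \<subseteq> H" by (rule face_in_facet)
    then obtain B where B: "B \<in> S" "H \<subseteq> B" "H \<subseteq> F" by (auto simp: facets_def)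
    have "B \<inter> F \<in> ?Q" using B by auto
    then have "B \<inter> F = H" using H(1) B by (auto simp: facets_def)
    moreover have "int (card H) = int (card F) - 1"
      using pure H(1) by (auto simp: pure_of_dim_def dim_face_def)
    ultimately show "\<exists>B\<in>S. A \<inter> F \<subseteq> B \<and> card (B \<inter> F) + 1 = card F"
      using B H(2) by (intro bexI[of _ B]) auto
  qed
next
  let ?Q = "Pow F \<inter> (\<Union>A\<in>S. Pow A)"
  assume step: "shelling_step S F"
  show "pure_of_dim (dim_face F - 1) ?Q"
    unfolding pure_of_dim_def
  proof
    fix H assume H: "H \<in> facets ?Q"
    then obtain A where A: "A \<in> S" "H \<subseteq> A" "H \<subseteq> F" by (auto simp: facets_def)
    then obtain B where B: "B \<in> S" "A \<inter> F \<subseteq> B" "card (B \<inter> F) + 1 = card F"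
      using step unfolding shelling_step_def by blast
    have "B \<inter> F \<in> ?Q" "H \<subseteq> B \<inter> F" using A B by auto
    then have "B \<inter> F = H" using H unfolding facets_def by blast
    then show "dim_face H = dim_face F - 1" using B(3) by (simp add: dim_face_def)
  qed
qed

lemma shellable_iff:
  assumes "simplicial_complex D"
  shows "shellable D \<longleftrightarrow> (\<exists>Fs. distinct Fs \<and> set Fs = facets D \<and>
           (\<forall>j<length Fs. shelling_step (set (take j Fs)) (Fs ! j)))"
proof -
  have "(j > 0 \<longrightarrow> pure_of_dim (dim_face (Fs ! j) - 1) (Pow (Fs ! j) \<inter> (\<Union>i<j. Pow (Fs ! i))))
      \<longleftrightarrow> shelling_step (set (take j Fs)) (Fs ! j)"
    if Fs: "distinct Fs" "set Fs = facets D" and j: "j < length Fs" for Fs j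
  proof (cases "j = 0")
    case True
    then show ?thesis by (simp add: shelling_step_def)
  next
    case False
    have img: "set (take j Fs) = (!) Fs ` {..<j}"
      using nth_image[of j Fs] j by (simp add: atLeast0LessThan)
    have Fj: "Fs ! j \<in> facets D" using Fs j by (metis nth_mem)
    have not_sub: "\<not> Fs ! j \<subseteq> A" if A: "A \<in> set (take j Fs)" for A
    proof
      assume sub: "Fs ! j \<subseteq> A"
      obtain i where i: "i < j" "A = Fs ! i" using A img by auto
      then have "A \<in> D" using Fs j nth_mem[of i Fs] by (auto simp: facets_def)
      then have "Fs ! i = Fs ! j" using Fj sub i by (auto simp: facets_def)
      then show False using Fs(1) i j by (simp add: nth_eq_iff_index_eq)
    qed
    have "finite (Fs ! j)" using Fj assms by (auto simp: facets_def simplicial_complex_def)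
    moreover have "Fs ! j \<noteq> {}" using not_sub[of "Fs ! 0"] img False by auto
    ultimately have "pure_of_dim (dim_face (Fs ! j) - 1) (Pow (Fs ! j) \<inter> (\<Union>A\<in>set (take j Fs). Pow A))
        \<longleftrightarrow> shelling_step (set (take j Fs)) (Fs ! j)"
      using not_sub by (rule pure_of_dim_iff_shelling_step)
    then show ?thesis using False by (simp add: img)
  qed
  then show ?thesis unfolding shellable_def by (metis (no_types, lifting))
qed

text \<open>The shedding condition guarantees that no facet of the deletion can be enlarged by
  \<open>x\<close> within \<open>D\<close>.\<close>

lemma facets_shedding:
  assumes "simplicial_complex D" "facets (deletion D x) \<subseteq> facets D"
  shows "facets D = facets (deletion D x) \<union> insert x ` facets (link D {x})"
proof (rule set_eqI, rule iffI)
  fix F assume F: "F \<in> facets D"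
  show "F \<in> facets (deletion D x) \<union> insert x ` facets (link D {x})"
  proof (cases "x \<in> F")
    case True
    then have eq: "insert x (F - {x}) = F" by blast
    have "F - {x} \<in> D" using F simplicial_complexD(3)[OF assms(1), of F "F - {x}"] by (auto simp: facets_def)
    then have "F - {x} \<in> link D {x}" using F eq by (auto simp: link_def facets_def)
    moreover have "G = F - {x}" if "G \<in> link D {x}" "F - {x} \<subseteq> G" for G
    proof -
      have "insert x G \<in> D" "x \<notin> G" using that by (auto simp: link_def)
      moreover have "F \<subseteq> insert x G" using that by blast
      ultimately have "insert x G = F" using F by (auto simp: facets_def)
      then show ?thesis using \<open>x \<notin> G\<close> by blast
    qed
    ultimately have "F - {x} \<in> facets (link D {x})" by (simp add: facets_def)
    then show ?thesis using eq by blast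
  next
    case False
    then show ?thesis using F by (auto simp: facets_def deletion_def)
  qed
next
  fix F assume "F \<in> facets (deletion D x) \<union> insert x ` facets (link D {x})"
  then show "F \<in> facets D"
  proof
    assume "F \<in> insert x ` facets (link D {x})"
    then obtain G where G: "G \<in> facets (link D {x})" "F = insert x G" by auto
    have "H = F" if "H \<in> D" "F \<subseteq> H" for H
    proof -
      have H: "insert x (H - {x}) = H" using that G by auto
      have "H - {x} \<in> D" using simplicial_complexD(3)[OF assms(1) that(1)] by blast
      then have "H - {x} \<in> link D {x}" using that H by (auto simp: link_def)
      moreover have "x \<notin> G" using G by (auto simp: facets_def link_def)
      then have "G \<subseteq> H - {x}" using that G by blast
      ultimately have "H - {x} = G" using G by (auto simp: facets_def)
      then show ?thesis using G H by simp
    qed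
    moreover have "F \<in> D" using G by (auto simp: facets_def link_def)
    ultimately show ?thesis by (simp add: facets_def)
  qed (use assms in auto)
qed

text \<open>A shelling of the deletion is followed by a shelling of the link with \<open>x\<close>
  joined to every facet.\<close>

lemma vertex_decomposable_imp_shellable:
  assumes "vertex_decomposable D" "simplicial_complex D"
  shows "shellable D"
  using assms
proof (induction rule: vertex_decomposable.induct)
  case void
  have "facets {} = ({} :: 'a set set)" by (simp add: facets_def)
  then show ?case by (auto simp: shellable_def)
next
  case (simplex F)
  have "facets (Pow F) = {F}" by (auto simp: facets_def)
  then show ?case unfolding shellable_def by (intro exI[of _ "[F]"]) auto
next
  case (shedding x D)
  note del = simplicial_complex_deletion[OF shedding.prems, of x]
  note lk = simplicial_complex_link[OF shedding.prems, of "{x}"]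
  obtain As where As: "distinct As" "set As = facets (deletion D x)"
      "\<And>j. j < length As \<Longrightarrow> shelling_step (set (take j As)) (As ! j)"
    using shedding.IH(1)[OF del] shellable_iff[OF del] by auto
  obtain Bs where Bs: "distinct Bs" "set Bs = facets (link D {x})"
      "\<And>j. j < length Bs \<Longrightarrow> shelling_step (set (take j Bs)) (Bs ! j)"
    using shedding.IH(2)[OF lk] shellable_iff[OF lk] by auto
  have xA: "x \<notin> A" if "A \<in> set As" for A using that As by (auto simp: facets_def deletion_def)
  have xB: "x \<notin> B" "B \<in> deletion D x" if "B \<in> set Bs" for B
    using that Bs by (auto simp: facets_def link_def deletion_def)
  define Fs where "Fs = As @ map (insert x) Bs"
  have "inj_on (insert x) (set Bs)" using xB(1) by (intro inj_onI) (metis insert_ident)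
  moreover have "set As \<inter> insert x ` set Bs = {}" using xA by blast
  ultimately have "distinct Fs" using As(1) Bs(1) by (simp add: Fs_def distinct_map)
  moreover have "set Fs = facets D"
    using facets_shedding[OF shedding.prems shedding.hyps(2)] As Bs by (simp add: Fs_def)
  moreover have "shelling_step (set (take j Fs)) (Fs ! j)" if j: "j < length Fs" for j
  proof (cases "j < length As")
    case True
    then show ?thesis using As(3) by (simp add: Fs_def nth_append)
  next
    case False
    define k where "k = j - length As"
    have k: "k < length Bs" using j False by (auto simp: Fs_def k_def)
    have Bk: "Bs ! k \<in> set Bs" using k by simp
    have tk: "set (take k Bs) \<subseteq> set Bs" by (rule set_take_subset)
    have Fj: "Fs ! j = insert x (Bs ! k)" using False k by (simp add: Fs_def nth_append k_def)
    have take: "set (take j Fs) = set As \<union> insert x ` set (take k Bs)"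
      using False by (simp add: Fs_def k_def take_map)
    have fin: "finite (Bs ! k)" using xB(2)[OF Bk] del by (auto simp: simplicial_complex_def)
    show ?thesis
      unfolding shelling_step_def Fj take
    proof
      fix A assume "A \<in> set As \<union> insert x ` set (take k Bs)"
      then show "\<exists>B\<in>set As \<union> insert x ` set (take k Bs). A \<inter> insert x (Bs ! k) \<subseteq> B \<and>
          card (B \<inter> insert x (Bs ! k)) + 1 = card (insert x (Bs ! k))"
      proof
        assume A: "A \<in> set As"
        \<comment> \<open>The link facet \<open>Bs ! k\<close> is a face of the deletion. A facet
          \<open>B\<close> of the deletion over it meets \<open>insert x (Bs ! k)\<close> exactly in
          \<open>Bs ! k\<close>, which has codimension one and absorbs the intersection with any
          \<open>A\<close> avoiding \<open>x\<close>.\<close>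
        obtain B where B: "B \<in> facets (deletion D x)" "Bs ! k \<subseteq> B"
          using face_in_facet[OF simplicial_complexD(1)[OF del] xB(2)[OF Bk]] by blast
        then have "x \<notin> B" using As xA by blast
        then have "B \<inter> insert x (Bs ! k) = Bs ! k" using B by blast
        moreover have "A \<inter> insert x (Bs ! k) \<subseteq> B" using A xA B by blast
        ultimately show ?thesis using B As fin xB(1)[OF Bk] by (intro bexI[of _ B]) auto
      next
        assume "A \<in> insert x ` set (take k Bs)"
        then obtain A' where A': "A = insert x A'" "A' \<in> set (take k Bs)" by auto
        then obtain B where B: "B \<in> set (take k Bs)" "A' \<inter> Bs ! k \<subseteq> B" "card (B \<inter> Bs ! k) + 1 = card (Bs ! k)"
          using Bs(3)[OF k] unfolding shelling_step_def by blast
        have "insert x B \<inter> insert x (Bs ! k) = insert x (B \<inter> Bs ! k)" by blast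
        then have "card (insert x B \<inter> insert x (Bs ! k)) + 1 = card (insert x (Bs ! k))"
          using B(3) xB(1)[OF Bk] fin by simp
        then show ?thesis using B A' by (intro bexI[of _ "insert x B"]) auto
      qed
    qed
  qed
  ultimately show ?case using shellable_iff[OF shedding.prems] by blast
qed

lemma gap_sym: "gap C A B \<Longrightarrow> gap C B A"
  unfolding gap_def by (metis Int_commute Un_commute)

text \<open>Of \<open>V - A\<close> and \<open>V - B\<close>, consider the later one in a shelling;
  by \<open>gap_sym\<close> let it be \<open>V - B\<close>. The earlier facet \<open>V - W\<close>
  of codimension one over their intersection has \<open>W\<close> inside \<open>A Un B\<close>, so
  \<open>W\<close> is \<open>A\<close> or \<open>B\<close>. For \<open>W = A\<close> the
  intersection has codimension \<open>d\<close>, which is at least 2; for \<open>W = B\<close> it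
  has codimension 0.\<close>

lemma gap_imp_not_shellable:
  assumes gap: "gap C A B" and C: "C \<subseteq> nsets V d" and "d \<ge> 2" "finite V"
  shows "\<not> shellable (dual_complex V C)"
proof
  assume "shellable (dual_complex V C)"
  then obtain Fs where Fs: "distinct Fs" "set Fs = (\<lambda>W. V - W) ` C"
      "\<And>j. j < length Fs \<Longrightarrow> shelling_step (set (take j Fs)) (Fs ! j)"
    using shellable_iff[OF simplicial_complex_dual[OF \<open>finite V\<close>]] facets_dual_complex[OF C] by auto
  have False if g: "gap C A B" and ij: "i < j" "j < length Fs" "Fs ! i = V - A" "Fs ! j = V - B" for A B i j
  proof -
    have AB: "A \<in> nsets V d" "B \<in> nsets V d" "A \<inter> B = {}" using g C unfolding gap_def by blast+
    have "V - A \<in> set (take j Fs)" using ij by (metis in_set_conv_nth length_take less_imp_le_nat min.absorb2 nth_take)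
    then obtain X where X: "X \<in> set (take j Fs)" "(V - A) \<inter> (V - B) \<subseteq> X" "card (X \<inter> (V - B)) + 1 = card (V - B)"
      using Fs(3)[OF ij(2)] unfolding shelling_step_def ij(4) by blast
    have "X \<in> (\<lambda>W. V - W) ` C" using X(1) set_take_subset[of j Fs] unfolding Fs(2) by (rule rev_subsetD)
    then obtain W where W: "W \<in> C" "X = V - W" by blast
    have "W \<subseteq> V" using subsetD[OF C W(1)] by (simp add: nsets_iff)
    then have "W \<subseteq> A \<union> B" using X(2) W by blast
    then consider "W = A" | "W = B" using g W unfolding gap_def by blast
    then show False
    proof cases
      case 1
      have "(V - A) \<inter> (V - B) = V - (A \<union> B)" by blast
      moreover have "card (V - (A \<union> B)) = card V - 2 * d" "card (V - B) = card V - d" "2 * d \<le> card V"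
      proof -
        have cu: "card (A \<union> B) = 2 * d" "A \<union> B \<subseteq> V"
          using AB card_Un_disjoint[of A B] unfolding nsets_iff by auto
        then show "card (V - (A \<union> B)) = card V - 2 * d"
          using finite_subset[OF cu(2) \<open>finite V\<close>] by (simp add: card_Diff_subset)
        show "2 * d \<le> card V" using cu card_mono[OF \<open>finite V\<close> cu(2)] by simp
        show "card (V - B) = card V - d" using AB(2) by (simp add: nsets_iff card_Diff_subset)
      qed
      ultimately show False using X(3) W 1 \<open>d \<ge> 2\<close> by simp
    next
      case 2
      then show False using X(3) W by simp
    qed
  qed
  note * = this
  have "V - A \<in> set Fs" "V - B \<in> set Fs" using gap Fs(2) by (auto simp: gap_def)
  then obtain i j where ij: "i < length Fs" "Fs ! i = V - A" "j < length Fs" "Fs ! j = V - B"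
    by (metis in_set_conv_nth)
  have "i \<noteq> j"
  proof
    assume "i = j"
    then have "V - A = V - B" using ij by simp
    moreover have AB: "A \<in> nsets V d" "B \<in> nsets V d" "A \<inter> B = {}" using gap C unfolding gap_def by blast+
    ultimately have "A = {}" unfolding nsets_iff by blast
    then show False using AB(1) \<open>d \<ge> 2\<close> by (simp add: nsets_iff)
  qed
  then show False using *[OF gap] *[OF gap_sym[OF gap]] ij by (metis linorder_neqE_nat)
qed


section \<open>Homology and Cohen-Macaulayness\<close>

text \<open>
  In contrast to \<^const>\<open>boundary\<close>, the sum ranges over a fixed vertex set, so that the operator is
  the same for a complex, its links and its deletions.
\<close>

definition bd :: "'a::linorder set \<Rightarrow> ('a set \<Rightarrow> 'k::field) \<Rightarrow> 'a set \<Rightarrow> 'k" where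
  "bd V f T = (\<Sum>v\<in>V - T. (- 1) ^ card {w \<in> T. w < v} * f (insert v T))"

definition supported :: "'a set \<Rightarrow> ('a set \<Rightarrow> 'k::field) \<Rightarrow> bool" where
  "supported W f \<longleftrightarrow> (\<forall>S. f S \<noteq> 0 \<longrightarrow> S \<subseteq> W)"

text \<open>The sign is the one that \<open>bd\<close> attaches to \<open>x\<close>, so removing
  \<open>x\<close> from the cone returns \<open>f\<close> with coefficient 1.
  \<open>link_part\<close> undoes the cone with the same sign, and every chain is its
  \<open>deletion_part\<close> plus the cone over its \<open>link_part\<close>.\<close>

definition cone :: "'a::linorder \<Rightarrow> ('a set \<Rightarrow> 'k::field) \<Rightarrow> 'a set \<Rightarrow> 'k" where
  "cone x f S = (if x \<in> S then (- 1) ^ card {w \<in> S. w < x} * f (S - {x}) else 0)"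

definition link_part :: "'a::linorder \<Rightarrow> ('a set \<Rightarrow> 'k::field) \<Rightarrow> 'a set \<Rightarrow> 'k" where
  "link_part x f S = (if x \<in> S then 0 else (- 1) ^ card {w \<in> S. w < x} * f (insert x S))"

definition deletion_part :: "'a \<Rightarrow> ('a set \<Rightarrow> 'k::field) \<Rightarrow> 'a set \<Rightarrow> 'k" where
  "deletion_part x f S = (if x \<in> S then 0 else f S)"

lemma boundary_eq_bd:
  assumes "finite V" "\<Union>D \<subseteq> V" "f \<in> chains D i"
  shows "boundary D f = bd V f"
proof
  fix T
  show "boundary D f T = bd V f T"
    unfolding boundary_def bd_def
  proof (rule sum.mono_neutral_left)
    show "\<forall>v\<in>V - T - (\<Union>D - T). (- 1) ^ card {w \<in> T. w < v} * f (insert v T) = 0"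
      using assms(3) unfolding chains_def by auto
  qed (use assms in auto)
qed

lemma sign_square: "(- 1) ^ n * ((- 1) ^ n * c) = (c :: 'k::field)"
  by (simp flip: mult.assoc power_add mult_2)

lemma card_less_insert:
  assumes "finite T" "u \<notin> T"
  shows "card {w \<in> insert u T. w < v} = card {w \<in> T. w < v} + (if u < v then 1 else 0)"
proof -
  have "{w \<in> insert u T. w < v} = (if u < v then insert u {w \<in> T. w < v} else {w \<in> T. w < v})" by auto
  then show ?thesis using assms by simp
qed

lemma card_less_remove: "card {w \<in> T - {x}. w < x} = card {w \<in> T. w < (x :: 'a::linorder)}"
  by (rule arg_cong[where f = card]) auto

lemma card_less_insert_self: "card {w \<in> insert x T. w < x} = card {w \<in> T. w < (x :: 'a::linorder)}"
  by (rule arg_cong[where f = card]) auto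

lemma deletion_link_decomposition:
  "f S = deletion_part x f S + cone x (link_part x f) S"
proof (cases "x \<in> S")
  case True
  then have "cone x (link_part x f) S = (- 1) ^ card {w \<in> S. w < x} * ((- 1) ^ card {w \<in> S - {x}. w < x} * f S)"
    by (simp add: cone_def link_part_def insert_absorb)
  also have "\<dots> = f S" by (simp only: card_less_remove sign_square)
  finally show ?thesis using True by (simp add: deletion_part_def)
qed (simp add: deletion_part_def cone_def)

lemma bd_add: "bd V (\<lambda>S. f S + g S) T = bd V f T + bd V g T"
  by (simp add: bd_def algebra_simps sum.distrib)

lemma bd_diff: "bd V (\<lambda>S. f S - g S) T = bd V f T - bd V g T"
  by (simp add: bd_def algebra_simps sum_subtractf)

lemma bd_zero: "bd V (\<lambda>S. 0) = (\<lambda>T. 0)"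
  by (simp add: bd_def fun_eq_iff)

lemma supported_bd:
  assumes "supported W f"
  shows "supported W (bd V f)"
  unfolding supported_def
proof (intro allI impI)
  fix T assume "bd V f T \<noteq> 0"
  then obtain v where "f (insert v T) \<noteq> 0" unfolding bd_def by (metis (lifting) mult_zero_right sum.neutral)
  then show "T \<subseteq> W" using assms by (auto simp: supported_def)
qed

text \<open>Removing the apex gives back \<open>g\<close>; removing any other vertex commutes with
  the cone up to a minus sign.\<close>

lemma bd_cone:
  fixes g :: "'a::linorder set \<Rightarrow> 'k::field"
  assumes "finite V" "x \<in> V" "supported (V - {x}) g"
  shows "bd V (cone x g) T = g T - cone x (bd V g) T"
proof (cases "x \<in> T")
  case False
  have "bd V (cone x g) T = (\<Sum>v\<in>{x}. (- 1) ^ card {w \<in> T. w < v} * cone x g (insert v T))"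
    unfolding bd_def
    by (rule sum.mono_neutral_right) (use assms False in \<open>auto simp: cone_def\<close>)
  also have "\<dots> = (- 1) ^ card {w \<in> T. w < x} * ((- 1) ^ card {w \<in> insert x T. w < x} * g T)"
    using False by (simp add: cone_def)
  also have "\<dots> = g T" by (simp only: card_less_insert_self sign_square)
  finally show ?thesis using False by (simp add: cone_def)
next
  case True
  have g0: "g S = 0" if "x \<in> S" for S using assms(3) that by (auto simp: supported_def)
  \<comment> \<open>Exactly one of \<open>x < v\<close> and \<open>v < x\<close> holds, so exactly
    one of the two position counts grows by one. This is the source of the minus sign.\<close>
  have term_eq: "(- 1) ^ card {w \<in> T. w < v} * cone x g (insert v T) =
      - ((- 1) ^ card {w \<in> T. w < x} * ((- 1) ^ card {w \<in> T - {x}. w < v} * g (insert v (T - {x}))))"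
    if v: "v \<in> V - T" for v
  proof (cases "finite T")
    case fin: True
    have vx: "v \<noteq> x" "v \<notin> T" using v True by auto
    have c1: "card {w \<in> T. w < v} = card {w \<in> T - {x}. w < v} + (if x < v then 1 else 0)"
      using card_less_insert[of "T - {x}" x v] fin True by (simp add: insert_absorb)
    have c2: "card {w \<in> insert v T. w < x} = card {w \<in> T. w < x} + (if v < x then 1 else 0)"
      using card_less_insert[of T v x] fin vx by simp
    have "insert v T - {x} = insert v (T - {x})" using vx by auto
    then show ?thesis using vx True unfolding cone_def c2 by (simp add: c1 power_add)
  next
    \<comment> \<open>Position counts are default values on an infinite \<open>T\<close>, but there
      \<open>g\<close> vanishes because its support lies in the finite set \<open>V\<close>.\<close>
    case False
    then have "g (insert v (T - {x})) = 0" "g (insert v T - {x}) = 0"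
      using assms(1,3) unfolding supported_def
      by (metis finite.emptyI finite_Diff2 finite_Diff finite_insert finite_subset)+
    then show ?thesis by (simp add: cone_def)
  qed
  have "cone x (bd V g) T =
      (- 1) ^ card {w \<in> T. w < x} * (\<Sum>v\<in>V - (T - {x}). (- 1) ^ card {w \<in> T - {x}. w < v} * g (insert v (T - {x})))"
    using True by (simp add: cone_def bd_def)
  also have "(\<Sum>v\<in>V - (T - {x}). (- 1) ^ card {w \<in> T - {x}. w < v} * g (insert v (T - {x}))) =
      (\<Sum>v\<in>V - T. (- 1) ^ card {w \<in> T - {x}. w < v} * g (insert v (T - {x})))"
    by (rule sum.mono_neutral_right) (use assms g0 in auto)
  also have "(- 1) ^ card {w \<in> T. w < x} * \<dots> = - bd V (cone x g) T"
    unfolding bd_def sum_distrib_left sum_negf[symmetric]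
    by (rule sum.cong) (use term_eq in auto)
  finally show ?thesis using g0[OF True] by simp
qed

lemma supported_parts:
  assumes "supported (insert x W) f"
  shows "supported (W - {x}) (deletion_part x f)" "supported (W - {x}) (link_part x f)"
  using assms unfolding supported_def deletion_part_def link_part_def
  by (auto split: if_splits)

lemma bd_decomposition:
  assumes "finite V" "x \<in> V" "supported V f"
  shows "bd V f T = bd V (deletion_part x f) T + link_part x f T - cone x (bd V (link_part x f)) T"
proof -
  have "supported (V - {x}) (link_part x f)" using supported_parts(2)[of x V f] assms by (simp add: insert_absorb)
  moreover have "bd V f T = bd V (\<lambda>S. deletion_part x f S + cone x (link_part x f) S) T"
    using deletion_link_decomposition[of f _ x] by (simp add: bd_def)
  ultimately show ?thesis using assms by (simp add: bd_add bd_cone)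
qed

lemma supported_mono: "supported W f \<Longrightarrow> W \<subseteq> V \<Longrightarrow> supported V f"
  unfolding supported_def by blast

text \<open>Induction on the support replaces the usual cancellation in pairs. With \<open>f\<close>
  split at \<open>x\<close>, the term \<open>bd V ?g\<close> cancels against the leading term of the
  boundary of the cone over \<open>bd V ?g\<close>; the rest vanishes by induction.\<close>

lemma bd_bd:
  fixes f :: "'a::linorder set \<Rightarrow> 'k::field"
  assumes "finite V" "finite W" "W \<subseteq> V" "supported W f"
  shows "bd V (bd V f) = (\<lambda>T. 0)"
  using assms(2-)
proof (induction W arbitrary: f rule: finite_induct)
  case empty
  then have "bd V f = (\<lambda>T. 0)" unfolding bd_def supported_def fun_eq_iff by (auto intro!: sum.neutral)
  then show ?case by (simp add: bd_zero)
next
  case (insert x W)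
  let ?a = "deletion_part x f" and ?g = "link_part x f"
  have W: "W \<subseteq> V - {x}" "W - {x} = W" "x \<in> V" "W \<subseteq> V" using insert by auto
  have ag: "supported W ?a" "supported W ?g" using supported_parts[OF insert.prems(2)] W by simp_all
  have sg: "supported (V - {x}) (bd V ?g)" using supported_bd[OF ag(2)] W supported_mono by blast
  have IH: "bd V (bd V ?a) = (\<lambda>T. 0)" "bd V (bd V ?g) = (\<lambda>T. 0)" using insert.IH ag W by blast+
  have sf: "supported V f" using insert.prems supported_mono by blast
  have "bd V f = (\<lambda>T. bd V ?a T + ?g T - cone x (bd V ?g) T)"
    using bd_decomposition[OF assms(1) W(3) sf] by blast
  then have "bd V (bd V f) T = bd V (bd V ?a) T + bd V ?g T - bd V (cone x (bd V ?g)) T" for T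
    by (simp add: bd_add bd_diff)
  then show ?case using bd_cone[OF assms(1) W(3) sg] IH by (simp add: cone_def fun_eq_iff)
qed

section \<open>Acyclicity of links in vertex decomposable complexes\<close>

text \<open>This asks only that cycles be boundaries, for the operator over the fixed vertex set
  \<open>V\<close>; the converse inclusion comes from \<open>bd_bd\<close>.\<close>

definition acyclic_at :: "'k::field itself \<Rightarrow> 'a::linorder set \<Rightarrow> 'a set set \<Rightarrow> int \<Rightarrow> bool" where
  "acyclic_at K V D i \<longleftrightarrow> (\<forall>f \<in> chains D i. bd V f = (\<lambda>T. 0) \<longrightarrow> (\<exists>h \<in> chains D (i + 1). bd V h = (f :: 'a set \<Rightarrow> 'k)))"

lemma supported_chains: "f \<in> chains D i \<Longrightarrow> \<Union>D \<subseteq> V \<Longrightarrow> supported V f"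
  unfolding chains_def supported_def by blast

lemma bd_in_chains:
  assumes D: "simplicial_complex D" and f: "f \<in> chains D (i + 1)"
  shows "bd V f \<in> chains D i"
  unfolding chains_def
proof (intro CollectI allI impI)
  fix T assume "bd V f T \<noteq> 0"
  then obtain v where v: "v \<in> V - T" "f (insert v T) \<noteq> 0"
    unfolding bd_def by (metis (lifting) mult_zero_right sum.neutral)
  then have T: "insert v T \<in> D" "dim_face (insert v T) = i + 1" using f by (auto simp: chains_def)
  have "finite T" using simplicial_complexD(2)[OF D T(1)] by simp
  then have "dim_face T = i" using v T by (simp add: dim_face_def)
  then show "T \<in> D \<and> dim_face T = i" using simplicial_complexD(3)[OF D T(1)] by blast
qed

lemma acyclic_at_imp_vanishes:
  assumes D: "simplicial_complex D" and V: "finite V" "\<Union>D \<subseteq> V" and ac: "acyclic_at K V D i"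
  shows "reduced_homology_vanishes K D i"
  unfolding reduced_homology_vanishes_def
proof (rule set_eqI, rule iffI)
  fix f :: "'a set \<Rightarrow> 'b" assume "f \<in> cycles D i"
  then have f: "f \<in> chains D i" "boundary D f = (\<lambda>T. 0)" by (simp_all add: cycles_def)
  then have "bd V f = (\<lambda>T. 0)" using boundary_eq_bd[OF V f(1)] by simp
  then obtain h where h: "h \<in> chains D (i + 1)" "bd V h = f" using ac f(1) unfolding acyclic_at_def by blast
  then have "boundary D h = f" using boundary_eq_bd[OF V h(1)] by simp
  then show "f \<in> boundaries D i" using h unfolding boundaries_def by blast
next
  fix f :: "'a set \<Rightarrow> 'b" assume "f \<in> boundaries D i"
  then obtain h where h: "h \<in> chains D (i + 1)" "f = bd V h"
    using boundary_eq_bd[OF V] unfolding boundaries_def by blast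
  have f: "f \<in> chains D i" using bd_in_chains[OF D h(1)] h(2) by simp
  have "bd V f = (\<lambda>T. 0)" using bd_bd[OF V(1) V(1) _ supported_chains[OF h(1) V(2)]] h(2) by simp
  then show "f \<in> cycles D i" using f boundary_eq_bd[OF V f] by (simp add: cycles_def)
qed

text \<open>At a set through \<open>x\<close> only the cone term of \<open>bd_decomposition\<close>
  survives, so the link part is a cycle. The remaining terms then relate it to the boundary of the
  deletion part.\<close>

lemma cycle_parts:
  assumes V: "finite V" "x \<in> V" and f: "supported V f" "bd V f = (\<lambda>T. 0)"
  shows "bd V (link_part x f) = (\<lambda>T. 0)" "bd V (deletion_part x f) T = - link_part x f T"
proof -
  let ?a = "deletion_part x f" and ?g = "link_part x f"
  have "supported (V - {x}) ?a" "supported (V - {x}) ?g"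
    using supported_parts[of x V f] f V by (simp_all add: insert_absorb)
  then have avoid: "bd V ?a T = 0" "bd V ?g T = 0" if "x \<in> T" for T
    using supported_bd[of "V - {x}"] that unfolding supported_def by blast+
  have eq: "bd V ?a T + ?g T - cone x (bd V ?g) T = 0" for T
    using bd_decomposition[OF V f(1), of T] f(2) by simp
  show g: "bd V ?g = (\<lambda>T. 0)"
  proof
    fix T
    show "bd V ?g T = 0"
    proof (cases "x \<in> T")
      case False
      then show ?thesis using eq[of "insert x T"] avoid(1)[of "insert x T"]
        by (simp add: link_part_def cone_def)
    qed (use avoid in simp)
  qed
  show "bd V ?a T = - ?g T" using eq[of T] by (simp add: g cone_def eq_neg_iff_add_eq_0)
qed

lemma deletion_part_chains: "f \<in> chains D i \<Longrightarrow> deletion_part x f \<in> chains (deletion D x) i"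
  by (auto simp: chains_def deletion_part_def deletion_def)

lemma link_part_chains:
  assumes D: "simplicial_complex D" and f: "f \<in> chains D i"
  shows "link_part x f \<in> chains (link D {x}) (i - 1)"
  unfolding chains_def
proof (intro CollectI allI impI)
  fix S assume "link_part x f S \<noteq> 0"
  then have S: "x \<notin> S" "f (insert x S) \<noteq> 0" by (auto simp: link_part_def split: if_splits)
  then have xS: "insert x S \<in> D" "dim_face (insert x S) = i" using f by (auto simp: chains_def)
  have "finite S" "S \<in> D" using simplicial_complexD(2,3)[OF D xS(1)] by auto
  then show "S \<in> link D {x} \<and> dim_face S = i - 1" using S xS by (auto simp: link_def dim_face_def)
qed

lemma cone_chains:
  assumes D: "simplicial_complex D" and f: "f \<in> chains (link D {x}) i"
  shows "cone x f \<in> chains D (i + 1)"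
  unfolding chains_def
proof (intro CollectI allI impI)
  fix S assume "cone x f S \<noteq> 0"
  then have S: "x \<in> S" "f (S - {x}) \<noteq> 0" by (auto simp: cone_def split: if_splits)
  then have "S - {x} \<in> link D {x}" and d: "dim_face (S - {x}) = i" using f by (auto simp: chains_def)
  then have "S \<in> D" using S by (simp add: link_def insert_absorb)
  moreover have "finite S" by (rule simplicial_complexD(2)[OF D \<open>S \<in> D\<close>])
  moreover from this have "card S \<ge> 1" using S by (metis card_gt_0_iff One_nat_def Suc_leI empty_iff)
  ultimately show "S \<in> D \<and> dim_face S = i + 1" using d S by (simp add: dim_face_def of_nat_diff)
qed

lemma chains_mono: "f \<in> chains D i \<Longrightarrow> D \<subseteq> E \<Longrightarrow> f \<in> chains E i"
  unfolding chains_def by blast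

lemma chains_add: "f \<in> chains D i \<Longrightarrow> g \<in> chains D i \<Longrightarrow> (\<lambda>S. f S + g S) \<in> chains D i"
  unfolding chains_def mem_Collect_eq by (metis add_0)

lemma chains_diff: "f \<in> chains D i \<Longrightarrow> g \<in> chains D i \<Longrightarrow> (\<lambda>S. f S - g S) \<in> chains D i"
  unfolding chains_def mem_Collect_eq by (metis diff_0_right)

text \<open>
  The Mayer-Vietoris argument on chains: if \<open>g\<close> is the link part of a cycle \<open>f\<close> and \<open>g\<close> is the
  boundary of \<open>h\<close>, then adding the boundary of the cone over \<open>h\<close> moves \<open>f\<close> into the deletion.
\<close>

lemma acyclic_at_shedding:
  assumes D: "simplicial_complex D" and x: "{x} \<in> D" and V: "finite V" "\<Union>D \<subseteq> V"
    and del: "acyclic_at K V (deletion D x) i" and lk: "acyclic_at K V (link D {x}) (i - 1)"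
  shows "acyclic_at K V D i"
  unfolding acyclic_at_def
proof (intro ballI impI)
  fix f :: "'a set \<Rightarrow> 'b" assume f: "f \<in> chains D i" "bd V f = (\<lambda>T. 0)"
  let ?a = "deletion_part x f" and ?g = "link_part x f"
  have xV: "x \<in> V" using x V by auto
  note parts = cycle_parts[OF V(1) xV supported_chains[OF f(1) V(2)] f(2)]
  obtain h where h: "h \<in> chains (link D {x}) i" "bd V h = ?g"
    using lk link_part_chains[OF D f(1), of x] parts(1) unfolding acyclic_at_def by force
  have "link D {x} \<subseteq> deletion D x" by (auto simp: link_def deletion_def)
  then have k: "(\<lambda>S. ?a S + h S) \<in> chains (deletion D x) i"
    by (intro chains_add deletion_part_chains f chains_mono[OF h(1)])
  have "bd V (\<lambda>S. ?a S + h S) = (\<lambda>T. 0)" by (simp add: fun_eq_iff bd_add parts(2) h(2))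
  then obtain m where m: "m \<in> chains (deletion D x) (i + 1)" "bd V m = (\<lambda>S. ?a S + h S)"
    using del k unfolding acyclic_at_def by blast
  have "\<Union>(link D {x}) \<subseteq> V - {x}" using V(2) by (auto simp: link_def)
  then have sh: "supported (V - {x}) h" by (rule supported_chains[OF h(1)])
  have "bd V (\<lambda>S. m S - cone x h S) = f"
  proof
    fix T
    have "bd V (\<lambda>S. m S - cone x h S) T = ?a T + h T - (h T - cone x ?g T)"
      using bd_cone[OF V(1) xV sh, of T] by (simp add: bd_diff m(2) h(2))
    also have "\<dots> = f T" using deletion_link_decomposition[of f T x] by simp
    finally show "bd V (\<lambda>S. m S - cone x h S) T = f T" .
  qed
  moreover have "(\<lambda>S. m S - cone x h S) \<in> chains D (i + 1)"
    by (intro chains_diff chains_mono[OF m(1)] cone_chains[OF D] h) (auto simp: deletion_def)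
  ultimately show "\<exists>h \<in> chains D (i + 1). bd V h = f" by blast
qed

text \<open>For a cycle \<open>f\<close> and a vertex \<open>x\<close> of \<open>F\<close>, the
  boundary of the cone over \<open>?a\<close> is \<open>?a - cone x (bd V ?a)\<close>, which is
  \<open>?a + cone x ?g\<close>, that is, \<open>f\<close>.\<close>

lemma acyclic_at_simplex:
  assumes V: "finite V" "F \<subseteq> V" and i: "i < int (card F) - 1"
  shows "acyclic_at K V (Pow F) i"
  unfolding acyclic_at_def
proof (intro ballI impI)
  fix f :: "'a set \<Rightarrow> 'b" assume f: "f \<in> chains (Pow F) i" "bd V f = (\<lambda>T. 0)"
  have fin: "finite F" using V finite_subset by blast
  then have sc: "simplicial_complex (Pow F)" by (auto simp: simplicial_complex_def intro: finite_subset)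
  show "\<exists>h \<in> chains (Pow F) (i + 1). bd V h = f"
  proof (cases "F = {}")
    \<comment> \<open>Here the bound reads \<open>i < -1\<close>, and no face has such a
      dimension.\<close>
    case True
    then have "f = (\<lambda>T. 0)" using f(1) i by (auto simp: chains_def dim_face_def fun_eq_iff)
    then show ?thesis by (intro bexI[of _ "\<lambda>T. 0"]) (auto simp: bd_zero chains_def)
  next
    case False
    then obtain x where x: "x \<in> F" by auto
    let ?a = "deletion_part x f" and ?g = "link_part x f"
    have xV: "x \<in> V" using x V by auto
    have lk: "deletion (Pow F) x = link (Pow F) {x}" using x by (auto simp: deletion_def link_def)
    have sf: "supported V f" using supported_chains[OF f(1)] V by simp
    note parts = cycle_parts[OF V(1) xV sf f(2)]
    have sa: "supported (V - {x}) ?a" using supported_parts(1)[of x V f] sf xV by (simp add: insert_absorb)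
    have "bd V (cone x ?a) = f"
    proof
      fix T
      have "bd V (cone x ?a) T = ?a T - cone x (bd V ?a) T" by (rule bd_cone[OF V(1) xV sa])
      also have "\<dots> = ?a T + cone x ?g T" by (simp add: cone_def parts(2))
      also have "\<dots> = f T" using deletion_link_decomposition[of f T x] by simp
      finally show "bd V (cone x ?a) T = f T" .
    qed
    moreover have "cone x ?a \<in> chains (Pow F) (i + 1)"
      using cone_chains[OF sc] deletion_part_chains[OF f(1), of x] unfolding lk by blast
    ultimately show ?thesis by blast
  qed
qed

lemma link_link:
  assumes D: "simplicial_complex D" and "x \<in> F"
  shows "link D F = link (link D {x}) (F - {x})"
proof (rule set_eqI)
  fix G
  have eq: "G \<union> (F - {x}) \<union> {x} = G \<union> F" using assms(2) by auto
  have "G \<union> {x} \<in> D" "G \<union> (F - {x}) \<in> D" if "G \<union> F \<in> D"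
    using simplicial_complexD(3)[OF D that, of "G \<union> {x}"] simplicial_complexD(3)[OF D that, of "G \<union> (F - {x})"]
      assms(2) by blast+
  moreover have "G \<inter> F = {} \<longleftrightarrow> G \<inter> {x} = {} \<and> G \<inter> (F - {x}) = {}" using assms(2) by blast
  ultimately show "G \<in> link D F \<longleftrightarrow> G \<in> link (link D {x}) (F - {x})"
    unfolding link_def mem_Collect_eq eq using assms(2) by blast
qed

text \<open>With all facets of size \<open>m\<close>, the bound on \<open>i\<close> is the dimension
  of the link of \<open>F\<close>. If \<open>x\<close> is in \<open>F\<close>, the link is one
  inside the link of \<open>x\<close>; if \<open>insert x F\<close> is not a face, it is one inside
  the deletion. Otherwise its own deletion and link at \<open>x\<close> are covered by induction and
  glued by \<open>acyclic_at_shedding\<close>.\<close>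

lemma link_acyclic:
  assumes "vertex_decomposable D" "simplicial_complex D" "\<forall>F\<in>facets D. card F = m"
    and "finite V" "\<Union>D \<subseteq> V" "F \<in> D" "i < int m - int (card F) - 1"
  shows "acyclic_at K V (link D F) i"
  using assms
proof (induction arbitrary: m F i rule: vertex_decomposable.induct)
  case void
  then show ?case by simp
next
  case (simplex E)
  have "facets (Pow E) = {E}" by (auto simp: facets_def)
  then have m: "m = card E" using simplex.prems(2) by auto
  have F: "F \<subseteq> E" "finite F" using simplex by (auto intro: finite_subset)
  have "link (Pow E) F = Pow (E - F)" using F by (auto simp: link_def)
  moreover have "acyclic_at K V (Pow (E - F)) i"
  proof (rule acyclic_at_simplex)
    have "card F \<le> card E" using F simplex by (simp add: card_mono)
    then show "i < int (card (E - F)) - 1" using F simplex m by (simp add: card_Diff_subset of_nat_diff)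
    show "E - F \<subseteq> V" using simplex by auto
  qed (use simplex in auto)
  ultimately show ?case by simp
next
  case (shedding x D)
  note D = shedding.prems(1) and pure = shedding.prems(2) and V = shedding.prems(3,4)
    and F = shedding.prems(5) and i = shedding.prems(6)
  note fac = facets_shedding[OF D shedding.hyps(2)]
  have D1: "simplicial_complex (deletion D x)" "\<Union>(deletion D x) \<subseteq> V"
    "\<forall>G\<in>facets (deletion D x). card G = m"
    using simplicial_complex_deletion[OF D] V(2) pure fac by (auto simp: deletion_def)
  have D2: "simplicial_complex (link D {x})" "\<Union>(link D {x}) \<subseteq> V"
    using simplicial_complex_link[OF D, of "{x}"] V(2) by (simp, auto simp: link_def)
  have card2: "Suc (card G) = m" if G: "G \<in> facets (link D {x})" for G
  proof -
    have "card (insert x G) = m" using fac G pure by blast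
    moreover have "x \<notin> G" "finite G" using G simplicial_complexD(2)[OF D2(1)] by (auto simp: facets_def link_def)
    ultimately show ?thesis by simp
  qed
  then have D2': "\<forall>G\<in>facets (link D {x}). card G = m - 1" by fastforce
  have "{} \<in> link D {x}" using shedding.hyps(1) simplicial_complexD(3)[OF D] by (auto simp: link_def)
  then obtain G where "G \<in> facets (link D {x})" using face_in_facet[OF simplicial_complexD(1)[OF D2(1)]] by blast
  \<comment> \<open>This keeps the facet size \<open>m - 1\<close> of the link from being
    truncated.\<close>
  then have m: "m \<ge> 1" using card2 by fastforce
  have finF: "finite F" by (rule simplicial_complexD(2)[OF D F])
  consider "x \<in> F" | "x \<notin> F" "insert x F \<notin> D" | "x \<notin> F" "insert x F \<in> D" by blast
  then show ?case
  proof cases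
    case 1
    have "F - {x} \<in> D" using simplicial_complexD(3)[OF D F, of "F - {x}"] by blast
    then have Fx: "F - {x} \<in> link D {x}" using 1 F by (auto simp: link_def insert_absorb)
    have "card F = Suc (card (F - {x}))" using finF 1 by (metis card.remove)
    then have "i < int (m - 1) - int (card (F - {x})) - 1" using i m by (simp add: of_nat_diff)
    then have "acyclic_at K V (link (link D {x}) (F - {x})) i"
      by (rule shedding.IH(2)[OF D2(1) D2' V(1) D2(2) Fx])
    then show ?thesis using link_link[OF D 1] by simp
  next
    case 2
    have "x \<notin> G" if "G \<union> F \<in> D" for G
      using 2(2) simplicial_complexD(3)[OF D that, of "insert x F"] by blast
    then have "link D F = link (deletion D x) F" using 2 by (auto simp: link_def deletion_def)
    moreover have "F \<in> deletion D x" using 2 F by (simp add: deletion_def)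
    ultimately show ?thesis using shedding.IH(1)[OF D1(1) D1(3) V(1) D1(2) _ i] by simp
  next
    case 3
    have "F \<in> deletion D x" using 3 F by (simp add: deletion_def)
    then have "acyclic_at K V (link (deletion D x) F) i" by (rule shedding.IH(1)[OF D1(1) D1(3) V(1) D1(2) _ i])
    moreover have "deletion (link D F) x = link (deletion D x) F" using 3 by (auto simp: link_def deletion_def)
    ultimately have 1: "acyclic_at K V (deletion (link D F) x) i" by simp
    have "F \<in> link D {x}" using 3 F by (auto simp: link_def)
    moreover have "i - 1 < int (m - 1) - int (card F) - 1" using i m by (simp add: of_nat_diff)
    ultimately have "acyclic_at K V (link (link D {x}) F) (i - 1)"
      by (rule shedding.IH(2)[OF D2(1) D2' V(1) D2(2)])
    moreover have "link (link D F) {x} = link (link D {x}) F"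
    proof (rule set_eqI)
      fix G
      have "G \<union> {x} \<in> D" "G \<union> F \<in> D" if "G \<union> {x} \<union> F \<in> D"
        using simplicial_complexD(3)[OF D that, of "G \<union> {x}"] simplicial_complexD(3)[OF D that, of "G \<union> F"] by blast+
      moreover have "G \<union> F \<union> {x} = G \<union> {x} \<union> F" "(G \<union> {x}) \<inter> F = {} \<longleftrightarrow> G \<inter> F = {}"
          "(G \<union> F) \<inter> {x} = {} \<longleftrightarrow> G \<inter> {x} = {}" using 3(1) by blast+
      ultimately show "G \<in> link (link D F) {x} \<longleftrightarrow> G \<in> link (link D {x}) F"
        unfolding link_def mem_Collect_eq by metis
    qed
    ultimately have 2: "acyclic_at K V (link (link D F) {x}) (i - 1)" by simp
    have x: "{x} \<in> link D F" using 3 shedding.hyps(1) by (auto simp: link_def)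
    have "\<Union>(link D F) \<subseteq> V" using V(2) by (auto simp: link_def)
    then show ?thesis using acyclic_at_shedding[OF simplicial_complex_link[OF D] x V(1) _ 1 2] by blast
  qed
qed

text \<open>A face of maximal dimension in the link of \<open>F\<close>, joined with
  \<open>F\<close>, lies in a facet of size \<open>m\<close>. So every degree below the dimension of
  the link is within the range of \<open>link_acyclic\<close>.\<close>

lemma vertex_decomposable_imp_cohen_macaulay:
  assumes vd: "vertex_decomposable D" and D: "simplicial_complex D" and pure: "\<forall>F\<in>facets D. card F = m"
  shows "cohen_macaulay K D"
  unfolding cohen_macaulay_def
proof (intro ballI allI impI)
  fix F i assume F: "F \<in> D" and i: "i < dim_complex (link D F)"
  have V: "finite (\<Union>D)" using simplicial_complexD(1,2)[OF D] by blast
  note lk = simplicial_complex_link[OF D, of F]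
  have "finite (dim_face ` link D F)" using simplicial_complexD(1)[OF lk] by simp
  moreover have "{} \<in> link D F" using F simplicial_complexD(3)[OF D F] by (simp add: link_def)
  ultimately have "dim_complex (link D F) \<in> dim_face ` link D F"
    unfolding dim_complex_def by (intro Max_in) auto
  then obtain G where G: "G \<in> link D F" "i < dim_face G" using i by auto
  then have "G \<union> F \<in> D" "G \<inter> F = {}" by (auto simp: link_def)
  then obtain H where H: "H \<in> facets D" "G \<union> F \<subseteq> H" using face_in_facet[OF simplicial_complexD(1)[OF D]] by blast
  have "finite H" using H simplicial_complexD(2)[OF D] by (auto simp: facets_def)
  then have "card (G \<union> F) \<le> m" using card_mono[OF _ H(2)] pure H(1) by simp
  moreover have "finite (G \<union> F)" using H(2) \<open>finite H\<close> by (rule finite_subset)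
  ultimately have "card G + card F \<le> m" using \<open>G \<inter> F = {}\<close> by (simp add: card_Un_disjoint)
  then have "i < int m - int (card F) - 1" using G(2) by (simp add: dim_face_def)
  then have "acyclic_at K (\<Union>D) (link D F) i" using link_acyclic[OF vd D pure V _ F] by blast
  moreover have "\<Union>(link D F) \<subseteq> \<Union>D" by (auto simp: link_def)
  ultimately show "reduced_homology_vanishes K (link D F) i"
    using acyclic_at_imp_vanishes[OF lk V] by blast
qed

section \<open>Gaps obstruct Cohen-Macaulayness\<close>

text \<open>The difference of two points in different components is a cycle. Were it the boundary of
  \<open>h\<close>, the part of \<open>h\<close> inside \<open>A\<close> would have the single point
  \<open>a\<close> as boundary, whose augmentation is 1 instead of 0.\<close>

lemma disjoint_simplices_homology:
  fixes A B :: "'a::linorder set"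
  assumes fin: "finite A" "finite B" and ab: "a \<in> A" "b \<in> B" and disj: "A \<inter> B = {}"
  shows "\<not> reduced_homology_vanishes TYPE('k::field) (Pow A \<union> Pow B) 0"
proof
  let ?D = "Pow A \<union> Pow B" and ?V = "A \<union> B"
  assume "reduced_homology_vanishes TYPE('k) ?D 0"
  then have van: "cycles ?D 0 = (boundaries ?D 0 :: ('a set \<Rightarrow> 'k) set)" by (simp add: reduced_homology_vanishes_def)
  have V: "finite ?V" "\<Union>?D \<subseteq> ?V" using fin by auto
  define f :: "'a set \<Rightarrow> 'k" where "f = (\<lambda>S. (if S = {a} then 1 else 0) - (if S = {b} then 1 else 0))"
  have neq: "a \<noteq> b" "a \<notin> B" "b \<notin> A" using ab disj by auto
  have f: "f \<in> chains ?D 0" using ab by (auto simp: chains_def f_def dim_face_def)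
  have "bd ?V f T = 0" for T
  proof (cases "T = {}")
    case True
    have "bd ?V f T = (\<Sum>v\<in>?V. (if v = a then 1 else 0) - (if v = b then 1 else 0))"
      unfolding bd_def True by (rule sum.cong) (auto simp: f_def)
    also have "\<dots> = 0" using V(1) ab by (simp add: sum_subtractf)
    finally show ?thesis .
  next
    case False
    have "f (insert v T) = 0" if "v \<in> ?V - T" for v
      using False that by (auto simp: f_def)
    then show ?thesis unfolding bd_def by (auto intro: sum.neutral)
  qed
  then have "f \<in> cycles ?D 0" using f boundary_eq_bd[OF V f] by (simp add: cycles_def fun_eq_iff)
  then have "f \<in> boundaries ?D 0" using van by simp
  then obtain h where h: "h \<in> chains ?D 1" "f = bd ?V h"
    unfolding boundaries_def using boundary_eq_bd[OF V] by fastforce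
  \<comment> \<open>No face meets both \<open>A\<close> and \<open>B\<close>, so restricting
    \<open>h\<close> to the faces inside \<open>A\<close> keeps its boundary at the vertices of
    \<open>A\<close> and makes it vanish at those of \<open>B\<close>.\<close>
  define hA where "hA = (\<lambda>S. if S \<subseteq> A then h S else 0)"
  have hA: "bd ?V hA {v} = (if v \<in> A then f {v} else 0)" if "v \<in> ?V" for v
  proof (cases "v \<in> A")
    case True
    have "h (insert w {v}) = hA (insert w {v})" for w
    proof (rule ccontr)
      assume "h (insert w {v}) \<noteq> hA (insert w {v})"
      then have "h (insert w {v}) \<noteq> 0" "\<not> insert w {v} \<subseteq> A" by (auto simp: hA_def split: if_splits)
      then have "insert w {v} \<subseteq> B" using h(1) by (auto simp: chains_def)
      then show False using True disj by auto
    qed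
    then show ?thesis using True by (simp add: h(2) bd_def)
  next
    case False
    then show ?thesis by (simp add: bd_def hA_def)
  qed
  have "supported A hA" by (simp add: supported_def hA_def)
  then have "bd ?V (bd ?V hA) {} = 0" using bd_bd[OF V(1) fin(1), of hA] by simp
  \<comment> \<open>At the empty set the boundary adds up the vertex coefficients.\<close>
  moreover have "bd ?V (bd ?V hA) {} = (\<Sum>v\<in>?V. if v \<in> A then f {v} else 0)"
    using hA by (simp add: bd_def)
  moreover have "\<dots> = (\<Sum>v\<in>?V. if v = a then 1 else 0)"
    by (rule sum.cong) (use neq ab in \<open>auto simp: f_def\<close>)
  moreover have "\<dots> = 1" using V(1) ab by simp
  ultimately show False by simp
qed

lemma gap_imp_not_cohen_macaulay:
  fixes C :: "'a::linorder set set"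
  assumes gap: "gap C A B" and C: "C \<subseteq> nsets V d" and "d \<ge> 2"
  shows "\<not> cohen_macaulay TYPE('k::field) (dual_complex V C)"
proof
  let ?D = "dual_complex V C" and ?F = "V - (A \<union> B)"
  assume cm: "cohen_macaulay TYPE('k) ?D"
  have AC: "A \<in> C" "B \<in> C" and disj: "A \<inter> B = {}" using gap by (auto simp: gap_def)
  have A: "finite A" "A \<subseteq> V" "card A = d" and B: "finite B" "B \<subseteq> V" "card B = d"
    using subsetD[OF C AC(1)] subsetD[OF C AC(2)] by (auto simp: nsets_iff)
  have F: "?F \<in> ?D" using AC unfolding dual_complex_def by blast
  have lk: "link ?D ?F = Pow A \<union> Pow B"
  proof (rule set_eqI, rule iffI)
    fix G assume "G \<in> link ?D ?F"
    then obtain W where W: "W \<in> C" "G \<union> ?F \<subseteq> V - W" "G \<inter> ?F = {}" unfolding link_def dual_complex_def by blast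
    have "W \<subseteq> V" using subsetD[OF C W(1)] by (simp add: nsets_iff)
    then have "W \<subseteq> A \<union> B" using W by blast
    then have "W = A \<or> W = B" using gap W unfolding gap_def by blast
    then show "G \<in> Pow A \<union> Pow B" using W by blast
  next
    fix G assume "G \<in> Pow A \<union> Pow B"
    then have "G \<union> ?F \<subseteq> V - B \<or> G \<union> ?F \<subseteq> V - A" "G \<inter> ?F = {}" using A B disj by auto
    then show "G \<in> link ?D ?F" using AC unfolding link_def dual_complex_def by blast
  qed
  have "dim_face A \<le> dim_complex (Pow A \<union> Pow B)"
    unfolding dim_complex_def using A B by (intro Max_ge) auto
  \<comment> \<open>As \<open>d\<close> is at least 2, degree 0 is strictly below the dimension of
    the link, where Reisner's condition applies.\<close>
  then have "0 < dim_complex (link ?D ?F)" using A(3) \<open>d \<ge> 2\<close> unfolding lk by (simp add: dim_face_def)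
  then have "reduced_homology_vanishes TYPE('k) (link ?D ?F) 0"
    using cm F unfolding cohen_macaulay_def by blast
  moreover obtain a b where "a \<in> A" "b \<in> B" using A B \<open>d \<ge> 2\<close> by fastforce
  ultimately show False using disjoint_simplices_homology[of A B a b] A B disj unfolding lk by blast
qed


section \<open>Connected sets\<close>

definition conn :: "('a \<times> 'a) set \<Rightarrow> 'a set \<Rightarrow> bool" where
  "conn E W \<longleftrightarrow> W \<noteq> {} \<and> (\<forall>u\<in>W. \<forall>v\<in>W. (u, v) \<in> (E \<inter> W \<times> W)\<^sup>*)"

text \<open>The edge relation stays fixed while the vertex set \<open>A\<close> shrinks, so
  discarding a vertex does not change \<open>E\<close>.\<close>

definition connected_sets :: "('a \<times> 'a) set \<Rightarrow> 'a set \<Rightarrow> nat \<Rightarrow> 'a set set" where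
  "connected_sets E A r = {W. W \<subseteq> A \<and> card W = r \<and> conn E W}"

lemma Con_eq_connected_sets:
  assumes "finite (fst G)"
  shows "Con r G = connected_sets (snd G) (fst G) r"
proof (rule set_eqI)
  fix W
  have "connected_graph (induced_subgraph G W) \<longleftrightarrow> conn (snd G) W" if "W \<subseteq> fst G"
    using inf_absorb2[OF that] by (simp add: connected_graph_def induced_subgraph_def conn_def)
  then show "W \<in> Con r G \<longleftrightarrow> W \<in> connected_sets (snd G) (fst G) r"
    using assms by (auto simp: Con_def nsets_iff connected_sets_def intro: finite_subset)
qed

lemma conn_singleton: "conn E {x}"
  by (simp add: conn_def)

lemma conn_insert:
  assumes "sym E" "conn E W" "w \<in> W" "(w, y) \<in> E"
  shows "conn E (insert y W)"
proof -
  let ?R = "E \<inter> insert y W \<times> insert y W"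
  have yw: "(w, y) \<in> ?R" "(y, w) \<in> ?R" using assms by (auto dest: symD)
  have "E \<inter> W \<times> W \<subseteq> ?R" by blast
  then have mono: "(E \<inter> W \<times> W)\<^sup>* \<subseteq> ?R\<^sup>*" by (rule rtrancl_mono)
  have "(u, w) \<in> ?R\<^sup>* \<and> (w, u) \<in> ?R\<^sup>*" if "u \<in> insert y W" for u
  proof (cases "u = y")
    case True
    then show ?thesis using yw by blast
  next
    case False
    then have "(u, w) \<in> (E \<inter> W \<times> W)\<^sup>*" "(w, u) \<in> (E \<inter> W \<times> W)\<^sup>*"
      using that assms(2,3) by (auto simp: conn_def)
    then show ?thesis using mono by blast
  qed
  then have "(u, v) \<in> ?R\<^sup>*" if "u \<in> insert y W" "v \<in> insert y W" for u v
    using that rtrancl_trans[of u w ?R v] by blast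
  then show ?thesis unfolding conn_def by blast
qed

lemma conn_subset_closed:
  assumes "conn E W" "u \<in> W" "u \<in> A" "\<And>a b. a \<in> W \<Longrightarrow> a \<in> A \<Longrightarrow> b \<in> W \<Longrightarrow> (a, b) \<in> E \<Longrightarrow> b \<in> A"
  shows "W \<subseteq> A"
proof
  fix v assume "v \<in> W"
  then have "(u, v) \<in> (E \<inter> W \<times> W)\<^sup>*" using assms(1,2) by (simp add: conn_def)
  then show "v \<in> A"
  proof (induction rule: rtrancl_induct)
    case (step y z)
    then show ?case using assms(4)[of y z] by blast
  qed (rule assms(3))
qed

text \<open>As long as \<open>U\<close> is a proper subset of the connected set \<open>T\<close>,
  some edge leaves \<open>U\<close> inside \<open>T\<close>; its end is added.\<close>

lemma conn_grow:
  assumes "sym E" "conn E S" "conn E T" "finite T" "S \<subseteq> T" "card S \<le> k" "k \<le> card T"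
  shows "\<exists>U. S \<subseteq> U \<and> U \<subseteq> T \<and> conn E U \<and> card U = k"
  using assms(6,7)
proof (induction k rule: dec_induct)
  case base
  then show ?case using assms(2,5) by blast
next
  case (step k)
  then obtain U where U: "S \<subseteq> U" "U \<subseteq> T" "conn E U" "card U = k" by auto
  have "U \<noteq> T" using U(4) step.prems by auto
  moreover obtain u where u: "u \<in> U" using U(3) by (auto simp: conn_def)
  ultimately obtain a y where y: "a \<in> U" "y \<in> T" "y \<notin> U" "(a, y) \<in> E"
    using conn_subset_closed[OF assms(3), of u U] U(2) by blast
  have "conn E (insert y U)" by (rule conn_insert[OF assms(1) U(3) y(1,4)])
  moreover have "card (insert y U) = Suc k" using y U finite_subset[OF U(2) assms(4)] by simp
  ultimately show ?case using U(1,2) y(2) by (intro exI[of _ "insert y U"]) auto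
qed

section \<open>Splitting families of connected sets\<close>

text \<open>These are the connected \<open>r\<close>-sets containing \<open>S\<close>, with
  \<open>S\<close> taken out: what is left of the generators after splitting off the vertices of
  \<open>S\<close>.\<close>

definition rooted_sets :: "('a \<times> 'a) set \<Rightarrow> 'a set \<Rightarrow> 'a set \<Rightarrow> nat \<Rightarrow> 'a set set" where
  "rooted_sets E A S r = {U. U \<subseteq> A - S \<and> card (S \<union> U) = r \<and> conn E (S \<union> U)}"

text \<open>Split at a neighbour \<open>y\<close> of the root: either \<open>y\<close> joins the
  root or it leaves \<open>A\<close>, and both shrink \<open>A - S\<close>. For the containment,
  \<open>insert y S\<close> is grown inside the \<open>r + 1\<close> vertices of
  \<open>insert y (S Un W)\<close> to \<open>r\<close> vertices, so that \<open>y\<close> takes the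
  place of a vertex of \<open>W\<close>.\<close>

lemma vertex_splittable_rooted_sets:
  assumes "sym E" "finite A" "S \<subseteq> A" "conn E S"
  shows "vertex_splittable (rooted_sets E A S r)"
  using assms(2-)
proof (induction "card (A - S)" arbitrary: A S rule: less_induct)
  case less
  note A = less.prems(1) and S = less.prems(2) and cS = less.prems(3)
  have fS: "finite S" using A S by (rule rev_finite_subset)
  have le: "card S \<le> r" if "U \<in> rooted_sets E A S r" for U
  proof -
    have "finite U" "card (S \<union> U) = r" using that A by (auto simp: rooted_sets_def intro: finite_subset)
    then show ?thesis using card_mono[of "S \<union> U" S] fS by simp
  qed
  consider "card S > r" | "card S = r" | "card S < r" by linarith
  then show ?case
  proof cases
    case 1
    then have "rooted_sets E A S r = {}" using le by fastforce
    then show ?thesis by (simp add: vertex_splittable.void)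
  next
    case 2
    have "U = {}" if U: "U \<in> rooted_sets E A S r" for U
    proof -
      have "U \<subseteq> A - S" "card (S \<union> U) = card S" using U 2 by (auto simp: rooted_sets_def)
      moreover from this have "finite (S \<union> U)" using A fS by (auto intro: finite_subset)
      ultimately have "S = S \<union> U" by (intro card_subset_eq) simp_all
      then show ?thesis using \<open>U \<subseteq> A - S\<close> by blast
    qed
    moreover have "{} \<in> rooted_sets E A S r" using 2 cS by (simp add: rooted_sets_def)
    ultimately have "rooted_sets E A S r = {{}}" by blast
    then show ?thesis by (simp add: vertex_splittable.unit)
  next
    case 3
    show ?thesis
    proof (cases "\<exists>s\<in>S. \<exists>y\<in>A - S. (s, y) \<in> E")
      case False
      have "U \<notin> rooted_sets E A S r" for U
      proof
        assume "U \<in> rooted_sets E A S r"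
        then have U: "U \<subseteq> A - S" "card (S \<union> U) = r" "conn E (S \<union> U)" by (auto simp: rooted_sets_def)
        obtain s where "s \<in> S" using cS by (auto simp: conn_def)
        then have "S \<union> U \<subseteq> S" using conn_subset_closed[OF U(3), of s S] False U(1) by blast
        then have "S \<union> U = S" by blast
        then show False using U(2) 3 by simp
      qed
      then have "rooted_sets E A S r = {}" by blast
      then show ?thesis by (simp add: vertex_splittable.void)
    next
      case True
      then obtain s y where y: "s \<in> S" "y \<in> A" "y \<notin> S" "(s, y) \<in> E" by blast
      have cy: "conn E (insert y S)" by (rule conn_insert[OF assms(1) cS y(1,4)])
      have "{W. y \<notin> W \<and> insert y W \<in> rooted_sets E A S r} = rooted_sets E A (insert y S) r"
        using y(2,3) by (auto simp: rooted_sets_def)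
      moreover have "vertex_splittable (rooted_sets E A (insert y S) r)"
      proof (rule less.hyps)
        show "card (A - insert y S) < card (A - S)" using A y by (intro psubset_card_mono) auto
      qed (use A S y cy in auto)
      moreover have "{W \<in> rooted_sets E A S r. y \<notin> W} = rooted_sets E (A - {y}) S r"
        by (auto simp: rooted_sets_def)
      moreover have "vertex_splittable (rooted_sets E (A - {y}) S r)"
      proof (rule less.hyps)
        show "card (A - {y} - S) < card (A - S)" using A y by (intro psubset_card_mono) auto
      qed (use A S y cS in auto)
      moreover have "\<exists>U\<subseteq>W. insert y U \<in> rooted_sets E A S r" if W: "W \<in> rooted_sets E A S r" "y \<notin> W" for W
      proof -
        have W': "W \<subseteq> A - S" "card (S \<union> W) = r" "conn E (S \<union> W)" using W by (auto simp: rooted_sets_def)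
        have fW: "finite (S \<union> W)" using fS W'(1) A by (auto intro: finite_subset)
        have cW: "conn E (insert y (S \<union> W))" by (rule conn_insert[OF assms(1) W'(3) _ y(4)]) (use y in simp)
        have "card (insert y (S \<union> W)) = Suc r" "card (insert y S) \<le> r" using fW fS W'(2) y(3) W(2) 3 by auto
        then obtain X where X: "insert y S \<subseteq> X" "X \<subseteq> insert y (S \<union> W)" "conn E X" "card X = r"
          using conn_grow[OF assms(1) cy cW _ _ _, of r] fW by fastforce
        have "S \<union> insert y (X - insert y S) = X" using X(1) by blast
        then have "insert y (X - insert y S) \<in> rooted_sets E A S r"
          using X y W'(1) by (auto simp: rooted_sets_def)
        moreover have "X - insert y S \<subseteq> W" using X(2) by blast
        ultimately show ?thesis by blast
      qed
      ultimately show ?thesis using vertex_splittable.split[of y "rooted_sets E A S r"] by simp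
    qed
  qed
qed

text \<open>The sets through \<open>x\<close> are rooted at \<open>{x}\<close>. A circuit avoiding
  \<open>x\<close> but adjacent to it can exchange one of its vertices for \<open>x\<close> by
  \<open>conn_grow\<close>, which gives the containment.\<close>

lemma vertex_splittable_connected_sets:
  assumes "sym E" "finite A" "x \<in> A" "r \<ge> 1"
    and rest: "vertex_splittable (connected_sets E (A - {x}) r)"
    and nbr: "\<And>W. W \<in> connected_sets E (A - {x}) r \<Longrightarrow> \<exists>w\<in>W. (w, x) \<in> E"
  shows "vertex_splittable (connected_sets E A r)"
proof (rule vertex_splittable.split[of x])
  have "{W. x \<notin> W \<and> insert x W \<in> connected_sets E A r} = rooted_sets E A {x} r"
    using assms(3) by (auto simp: connected_sets_def rooted_sets_def)
  then show "vertex_splittable {W. x \<notin> W \<and> insert x W \<in> connected_sets E A r}"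
    using vertex_splittable_rooted_sets[OF assms(1,2), of "{x}"] assms(3) conn_singleton by fastforce
  have avoid: "{W \<in> connected_sets E A r. x \<notin> W} = connected_sets E (A - {x}) r"
    by (auto simp: connected_sets_def)
  then show "vertex_splittable {W \<in> connected_sets E A r. x \<notin> W}" using rest by simp
  fix W assume "W \<in> connected_sets E A r" "x \<notin> W"
  then have W: "W \<in> connected_sets E (A - {x}) r" using avoid by blast
  then obtain w where w: "w \<in> W" "(w, x) \<in> E" using nbr by blast
  have W': "W \<subseteq> A - {x}" "card W = r" "conn E W" using W by (auto simp: connected_sets_def)
  have fW: "finite W" using finite_subset[OF W'(1)] assms(2) by simp
  have cW: "conn E (insert x W)" by (rule conn_insert[OF assms(1) W'(3) w])
  have "x \<notin> W" "card (insert x W) = Suc r" using W' fW by (auto simp: card_insert_if)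
  then obtain X where X: "{x} \<subseteq> X" "X \<subseteq> insert x W" "conn E X" "card X = r"
    using conn_grow[OF assms(1) conn_singleton cW, of x r] fW assms(4) by fastforce
  then have "insert x (X - {x}) \<in> connected_sets E A r"
    using W'(1) assms(3) by (auto simp: connected_sets_def insert_absorb)
  then show "\<exists>U\<subseteq>W. insert x U \<in> connected_sets E A r" using X(2) by blast
qed

lemma vertex_splittable_singleton:
  assumes "finite F"
  shows "vertex_splittable {F}"
  using assms
proof (induction rule: finite_induct)
  case empty
  show ?case by (rule vertex_splittable.unit)
next
  case (insert x F)
  show ?case
  proof (rule vertex_splittable.split[of x])
    have "{W. x \<notin> W \<and> insert x W \<in> {insert x F}} = {F}" using insert.hyps by (auto simp: insert_ident)
    then show "vertex_splittable {W. x \<notin> W \<and> insert x W \<in> {insert x F}}" using insert.IH by simp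
    have "{W \<in> {insert x F}. x \<notin> W} = {}" by blast
    then show "vertex_splittable {W \<in> {insert x F}. x \<notin> W}" by (simp only: vertex_splittable.void)
  qed blast
qed

section \<open>The ladder graph\<close>

definition ladder_edges :: "nat \<Rightarrow> ((nat \<times> nat) \<times> (nat \<times> nat)) set" where
  "ladder_edges n = snd (cartesian_product (path_graph n) (path_graph 2))"

lemma ladder_vertices: "fst (cartesian_product (path_graph n) (path_graph 2)) = {1..n} \<times> {1..2}"
  by (simp add: cartesian_product_def path_graph_def)

lemma ladder_edges_iff:
  "((i, j), (k, l)) \<in> ladder_edges n \<longleftrightarrow> i \<in> {1..n} \<and> k \<in> {1..n} \<and> j \<in> {1..2} \<and> l \<in> {1..2} \<and>
     (i = k \<and> (l = j + 1 \<or> j = l + 1) \<or> j = l \<and> (k = i + 1 \<or> i = k + 1))"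
  by (auto simp: ladder_edges_def cartesian_product_def path_graph_def)

lemma sym_ladder_edges: "sym (ladder_edges n)"
  unfolding sym_def by (auto simp: ladder_edges_iff)

text \<open>No edge jumps over column \<open>m\<close>, so \<open>W\<close> stays on one side. The
  choice of \<open>m\<close> leaves fewer than \<open>r\<close> vertices on the left and at most
  \<open>n\<close>, hence at most \<open>r\<close>, on the right; so \<open>W\<close> must fill the
  right side.\<close>

lemma ladder_avoiding_middle:
  assumes "n \<le> r" "r \<ge> 1" and m: "m = (n + 1) div 2"
    and W: "W \<in> connected_sets (ladder_edges n) ({1..n} \<times> {1..2} - {(m, 1)} - {(m, 2)}) r"
  shows "W = {m+1..n} \<times> {1..2}" "m + 1 \<le> n"
proof -
  let ?L = "{1..<m} \<times> {1..2::nat}" and ?R = "{m+1..n} \<times> {1..2::nat}"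
  have W': "W \<subseteq> {1..n} \<times> {1..2} - {(m, 1)} - {(m, 2)}" "card W = r" "conn (ladder_edges n) W"
    using W by (auto simp: connected_sets_def)
  have no_mid: "i \<noteq> m" if "(i, j) \<in> W" for i j
  proof
    assume "i = m"
    then have "j \<in> {1..2}" "j \<noteq> 1" "j \<noteq> 2" using that W'(1) by auto
    then show False by auto
  qed
  have LR: "W \<subseteq> ?L \<union> ?R"
  proof
    fix p assume p: "p \<in> W"
    obtain i j where ij: "p = (i, j)" by fastforce
    then have "i \<in> {1..n}" "j \<in> {1..2}" "i \<noteq> m" using p W'(1) no_mid by auto
    then show "p \<in> ?L \<union> ?R" using ij by auto
  qed
  have "W \<inter> ?L = {}"
  proof (rule ccontr)
    assume "W \<inter> ?L \<noteq> {}"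
    then obtain u where u: "u \<in> W" "u \<in> ?L" by blast
    have "W \<subseteq> ?L"
    proof (rule conn_subset_closed[OF W'(3) u])
      fix a b assume ab: "a \<in> W" "a \<in> ?L" "b \<in> W" "(a, b) \<in> ladder_edges n"
      obtain i j k l where "a = (i, j)" "b = (k, l)" by fastforce
      then have "k \<noteq> m" "k \<le> i + 1" "i < m" "k \<ge> 1" "l \<in> {1..2}"
        using ab no_mid by (auto simp: ladder_edges_iff)
      then show "b \<in> ?L" using \<open>b = (k, l)\<close> by auto
    qed
    then have "r \<le> card ?L" using card_mono[of ?L W] W'(2) by simp
    also have "\<dots> = 2 * (m - 1)" by simp
    also have "\<dots> < r" using assms(1,2) m by linarith
    finally show False by simp
  qed
  then have "W \<subseteq> ?R" using LR by blast
  moreover have "card ?R \<le> card W" using W'(2) assms(1) m by simp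
  ultimately show "W = ?R" by (intro card_seteq) auto
  then show "m + 1 \<le> n" using W'(2) assms(2) by (cases "m + 1 \<le> n") auto
qed

text \<open>The two middle vertices are split off in turn. A circuit avoiding \<open>(m, 1)\<close>
  contains \<open>(m, 2)\<close> or is the right half, and either way it contains a neighbour of
  \<open>(m, 1)\<close>.\<close>

lemma vertex_splittable_ladder:
  assumes "1 \<le> n" "n \<le> r"
  shows "vertex_splittable (connected_sets (ladder_edges n) ({1..n} \<times> {1..2}) r)"
proof -
  define m where "m = (n + 1) div 2"
  let ?V = "{1..n} \<times> {1..2::nat}" and ?E = "ladder_edges n"
  have m: "1 \<le> m" "m \<le> n" using assms by (auto simp: m_def)
  have r: "r \<ge> 1" using assms by simp
  note mid = ladder_avoiding_middle[OF assms(2) r m_def]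
  note nsplit = vertex_splittable_connected_sets[OF sym_ladder_edges _ _ r]
  have "connected_sets ?E (?V - {(m, 1)} - {(m, 2)}) r \<subseteq> {{m+1..n} \<times> {1..2}}" using mid(1) by blast
  then have "connected_sets ?E (?V - {(m, 1)} - {(m, 2)}) r = {} \<or>
      connected_sets ?E (?V - {(m, 1)} - {(m, 2)}) r = {{m+1..n} \<times> {1..2}}" by (rule subset_singletonD)
  moreover have "vertex_splittable {{m+1..n} \<times> {1..2::nat}}" by (rule vertex_splittable_singleton) simp
  ultimately have v2: "vertex_splittable (connected_sets ?E (?V - {(m, 1)} - {(m, 2)}) r)"
    using vertex_splittable.void by metis
  have v1: "vertex_splittable (connected_sets ?E (?V - {(m, 1)}) r)"
  proof (rule nsplit[OF _ _ v2])
    fix W assume W: "W \<in> connected_sets ?E (?V - {(m, 1)} - {(m, 2)}) r"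
    have "(m + 1, 2) \<in> W" using mid[OF W] by simp
    moreover have "((m + 1, 2), (m, 2)) \<in> ?E" using mid(2)[OF W] m by (simp add: ladder_edges_iff)
    ultimately show "\<exists>w\<in>W. (w, (m, 2)) \<in> ?E" by blast
  qed (use m in auto)
  show ?thesis
  proof (rule nsplit[OF _ _ v1])
    fix W assume W: "W \<in> connected_sets ?E (?V - {(m, 1)}) r"
    show "\<exists>w\<in>W. (w, (m, 1)) \<in> ?E"
    proof (cases "(m, 2) \<in> W")
      case True
      moreover have "((m, 2), (m, 1)) \<in> ?E" using m by (simp add: ladder_edges_iff)
      ultimately show ?thesis by blast
    next
      case False
      then have W2: "W \<in> connected_sets ?E (?V - {(m, 1)} - {(m, 2)}) r"
        using W by (auto simp: connected_sets_def)
      have "(m + 1, 1) \<in> W" using mid[OF W2] by simp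
      moreover have "((m + 1, 1), (m, 1)) \<in> ?E" using mid(2)[OF W2] m by (simp add: ladder_edges_iff)
      ultimately show ?thesis by blast
    qed
  qed (use m in auto)
qed

section \<open>A gap in long ladders\<close>

text \<open>A connected subset of \<open>A Un B\<close> cannot cross from one set to the other, so
  it lies in one of them and fills it by size.\<close>

lemma gap_connected_sets:
  assumes A: "A \<in> connected_sets E V r" and B: "B \<in> connected_sets E V r" and disj: "A \<inter> B = {}"
    and fin: "finite V" and no_edge: "\<And>a b. a \<in> A \<Longrightarrow> b \<in> B \<Longrightarrow> (a, b) \<notin> E \<and> (b, a) \<notin> E"
  shows "gap (connected_sets E V r) A B"
proof -
  have AB: "finite A" "card A = r" "finite B" "card B = r"
    using A B fin by (auto simp: connected_sets_def intro: finite_subset)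
  have "W = A \<or> W = B" if W: "W \<in> connected_sets E V r" "W \<subseteq> A \<union> B" for W
  proof -
    have W': "card W = r" "conn E W" using W by (auto simp: connected_sets_def)
    obtain u where u: "u \<in> W" using W'(2) by (auto simp: conn_def)
    then consider "u \<in> A" | "u \<in> B" using W(2) by blast
    then show ?thesis
    proof cases
      case 1
      have "W \<subseteq> A" by (rule conn_subset_closed[OF W'(2) u 1]) (use no_edge W(2) in blast)
      then have "W = A" by (intro card_subset_eq) (use W' AB in auto)
      then show ?thesis by blast
    next
      case 2
      have "W \<subseteq> B" by (rule conn_subset_closed[OF W'(2) u 2]) (use no_edge W(2) in blast)
      then have "W = B" by (intro card_subset_eq) (use W' AB in auto)
      then show ?thesis by blast
    qed
  qed
  then show ?thesis using A B disj unfolding gap_def by blast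
qed

text \<open>
  The vertices are numbered from \<open>0\<close>, column by column. Edges join only numbers that differ by at
  most 2, so two intervals of numbers are not adjacent once two numbers between them are left out.
\<close>

definition zigzag :: "nat \<Rightarrow> nat \<times> nat" where
  "zigzag k = (k div 2 + 1, k mod 2 + 1)"

lemma inj_zigzag: "inj zigzag"
proof (rule injI)
  fix k l assume "zigzag k = zigzag l"
  then have "k div 2 = l div 2" "k mod 2 = l mod 2" by (auto simp: zigzag_def)
  then show "k = l" by (metis div_mult_mod_eq)
qed

lemma zigzag_vertex: "zigzag k \<in> {1..n} \<times> {1..2} \<longleftrightarrow> k < 2 * n"
proof -
  have "k mod 2 + 1 \<le> 2" by simp
  moreover have "k div 2 + 1 \<le> n \<longleftrightarrow> k < 2 * n" by linarith
  ultimately show ?thesis by (simp add: zigzag_def)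
qed

lemma zigzag_edge_diff:
  assumes "(zigzag k, zigzag l) \<in> ladder_edges n"
  shows "l \<le> k + 2"
proof -
  have "k div 2 = l div 2 \<or> k mod 2 = l mod 2 \<and> (l div 2 = k div 2 + 1 \<or> k div 2 = l div 2 + 1)"
    using assms unfolding zigzag_def ladder_edges_iff by linarith
  moreover have "l = 2 * (l div 2) + l mod 2" "l mod 2 < 2" "k = 2 * (k div 2) + k mod 2" by simp_all
  ultimately show ?thesis by linarith
qed

lemma zigzag_edge_rail:
  assumes "k + 2 < 2 * n"
  shows "(zigzag k, zigzag (k + 2)) \<in> ladder_edges n"
proof -
  have "(k + 2) mod 2 = k mod 2" "(k + 2) div 2 = k div 2 + 1" "k mod 2 + 1 \<le> 2" by simp_all
  moreover have "k div 2 + 2 \<le> n" using assms by linarith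
  ultimately show ?thesis unfolding zigzag_def ladder_edges_iff by simp
qed

lemma zigzag_edge_rung:
  assumes "2 * k + 1 < 2 * n"
  shows "(zigzag (2 * k), zigzag (2 * k + 1)) \<in> ladder_edges n"
proof -
  have "(2 * k + 1) mod 2 = 1" "(2 * k) mod 2 = 0" "(2 * k + 1) div 2 = k" "(2 * k) div 2 = k" "k + 1 \<le> n"
    using assms by simp_all
  then show ?thesis unfolding zigzag_def ladder_edges_iff by simp
qed

text \<open>Each new number \<open>b\<close> is attached along a rail to \<open>b - 2\<close>; only
  the number 1 needs a rung, to 0.\<close>

lemma conn_zigzag_initial:
  assumes "1 \<le> b" "b \<le> 2 * n"
  shows "conn (ladder_edges n) (zigzag ` {0..<b})"
  using assms
proof (induction b rule: dec_induct)
  case base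
  then show ?case by (simp add: conn_singleton)
next
  case (step b)
  have "{0..<Suc b} = insert b {0..<b}" by auto
  moreover have "conn (ladder_edges n) (insert (zigzag b) (zigzag ` {0..<b}))"
  proof (cases "b = 1")
    case True
    then show ?thesis
      using conn_insert[OF sym_ladder_edges step.IH _ , of "zigzag 0" "zigzag b"] zigzag_edge_rung[of 0 n] step.prems
      by simp
  next
    case False
    then have b: "b - 2 + 2 = b" "b - 2 < b" using step.hyps by auto
    then have "(zigzag (b - 2), zigzag b) \<in> ladder_edges n" using zigzag_edge_rail[of "b - 2" n] step.prems by simp
    moreover have "zigzag (b - 2) \<in> zigzag ` {0..<b}" using b by simp
    ultimately show ?thesis using conn_insert[OF sym_ladder_edges step.IH] step.prems by simp
  qed
  ultimately show ?case by simp
qed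

text \<open>The interval grows downwards from the end of column \<open>e\<close>. As it ends with a
  complete column, its second vertex hangs on the first by a rung, and all later ones use
  rails.\<close>

lemma conn_zigzag_final:
  assumes "1 \<le> b" "b \<le> 2 * e" "e \<le> n"
  shows "conn (ladder_edges n) (zigzag ` {2 * e - b..<2 * e})"
  using assms(1,2)
proof (induction b rule: dec_induct)
  case base
  then have "{2 * e - 1..<2 * e} = {2 * e - 1}" by auto
  then show ?case by (simp add: conn_singleton)
next
  case (step b)
  define c where "c = 2 * e - Suc b"
  have c: "{2 * e - Suc b..<2 * e} = insert c {2 * e - b..<2 * e}" "c + b + 1 = 2 * e"
    using step.prems by (auto simp: c_def)
  have IH: "conn (ladder_edges n) (zigzag ` {2 * e - b..<2 * e})" using step.IH step.prems by simp
  have sy: "(zigzag c, zigzag d) \<in> ladder_edges n \<Longrightarrow> (zigzag d, zigzag c) \<in> ladder_edges n" for d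
    using sym_ladder_edges by (rule symD)
  have "conn (ladder_edges n) (insert (zigzag c) (zigzag ` {2 * e - b..<2 * e}))"
  proof (cases "b = 1")
    case True
    then have c2: "c = 2 * (e - 1)" "2 * (e - 1) + 1 = 2 * e - 1" using c(2) by auto
    then have "(zigzag c, zigzag (2 * e - 1)) \<in> ladder_edges n"
      using zigzag_edge_rung[of "e - 1" n] c(2) assms(3) by simp
    then have "(zigzag (2 * e - 1), zigzag c) \<in> ladder_edges n" by (rule sy)
    moreover have "zigzag (2 * e - 1) \<in> zigzag ` {2 * e - b..<2 * e}" using True c(2) by auto
    ultimately show ?thesis using conn_insert[OF sym_ladder_edges IH] by blast
  next
    case False
    then have c2: "c + 2 < 2 * e" "2 * e - b \<le> c + 2" using step.hyps c(2) by auto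
    then have "(zigzag (c + 2), zigzag c) \<in> ladder_edges n"
      using zigzag_edge_rail[of c n] assms(3) sy by simp
    moreover have "zigzag (c + 2) \<in> zigzag ` {2 * e - b..<2 * e}" using c2 by simp
    ultimately show ?thesis using conn_insert[OF sym_ladder_edges IH] by blast
  qed
  then show ?case by (simp add: c(1))
qed

lemma ladder_gap:
  assumes "r \<ge> 1" "r < n"
  shows "gap (connected_sets (ladder_edges n) ({1..n} \<times> {1..2}) r)
           (zigzag ` {0..<r}) (zigzag ` {r + 2..<2 * r + 2})"
proof -
  let ?A = "zigzag ` {0..<r}" and ?B = "zigzag ` {r + 2..<2 * r + 2}"
  have inj: "inj_on zigzag X" for X using inj_zigzag by (rule inj_on_subset) simp
  have card: "card ?A = r" "card ?B = r" by (simp_all add: card_image[OF inj])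
  have sub: "zigzag ` X \<subseteq> {1..n} \<times> {1..2}" if "\<And>k. k \<in> X \<Longrightarrow> k < 2 * n" for X
    using that zigzag_vertex by blast
  have A: "?A \<in> connected_sets (ladder_edges n) ({1..n} \<times> {1..2}) r"
    using conn_zigzag_initial[of r n] card(1) assms sub[of "{0..<r}"] by (simp add: connected_sets_def)
  \<comment> \<open>The second interval ends with column \<open>r + 1\<close>, which exists since
    \<open>r < n\<close>; the numbers \<open>r\<close> and \<open>r + 1\<close> separate it from the
    first.\<close>
  have "2 * (r + 1) - r = r + 2" "2 * (r + 1) = 2 * r + 2" by auto
  then have "conn (ladder_edges n) ?B" using conn_zigzag_final[of r "r + 1" n] assms by simp
  then have B: "?B \<in> connected_sets (ladder_edges n) ({1..n} \<times> {1..2}) r"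
    using card(2) assms sub[of "{r + 2..<2 * r + 2}"] by (simp add: connected_sets_def)
  have no_edge: "(a, b) \<notin> ladder_edges n" "(b, a) \<notin> ladder_edges n" if "a \<in> ?A" "b \<in> ?B" for a b
  proof -
    obtain k l where "a = zigzag k" "k < r" "b = zigzag l" "r + 2 \<le> l" using \<open>a \<in> ?A\<close> \<open>b \<in> ?B\<close> by auto
    then show "(a, b) \<notin> ladder_edges n" using zigzag_edge_diff[of k l n] by auto
    then show "(b, a) \<notin> ladder_edges n" using sym_ladder_edges by (meson symD)
  qed
  have disj: "?A \<inter> ?B = {}" unfolding image_Int[OF inj_zigzag, symmetric] by auto
  show ?thesis by (rule gap_connected_sets[OF A B disj]) (simp, use no_edge in blast)
qed

theorem theorem4p15:
  fixes n r :: nat and G :: "(nat \<times> nat) sgraph"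
  assumes "n \<ge> 1" and "r \<ge> 2"
    and "G = cartesian_product (path_graph n) (path_graph 2)"
  shows "(vertex_decomposable (Sigma_complex r G) \<longleftrightarrow> shellable (Sigma_complex r G))
       \<and> (shellable (Sigma_complex r G) \<longleftrightarrow> cohen_macaulay TYPE('k::field) (Sigma_complex r G))
       \<and> (cohen_macaulay TYPE('k) (Sigma_complex r G) \<longleftrightarrow> gap_free r G)
       \<and> (gap_free r G \<longleftrightarrow> n \<le> r)
       \<and> (n \<le> r \<longleftrightarrow> cochordal_clutter (fst G) r (Con r G))"
proof -
  have V: "fst G = {1..n} \<times> {1..2}" using ladder_vertices assms(3) by simp
  then have fin: "finite (fst G)" by simp
  have Con: "Con r G = connected_sets (ladder_edges n) ({1..n} \<times> {1..2}) r"
    using Con_eq_connected_sets[OF fin] V by (simp add: ladder_edges_def assms(3))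
  note uniform = Con_nsets[of r G]
  note sc = simplicial_complex_dual[OF fin, of "Con r G"]
  have gf: "gap_free r G \<longleftrightarrow> (\<nexists>A B. gap (Con r G) A B)" by (rule gap_free_iff) (use assms(2) in simp)
  show ?thesis
  \<comment> \<open>All six properties hold in the first case and all fail in the second.\<close>
  proof (cases "n \<le> r")
    case True
    have vs: "vertex_splittable (Con r G)" unfolding Con by (rule vertex_splittable_ladder[OF assms(1) True])
    have vd: "vertex_decomposable (Sigma_complex r G)"
      unfolding Sigma_complex_eq_dual by (rule vertex_splittable_imp_vertex_decomposable[OF vs fin uniform])
    have sh: "shellable (Sigma_complex r G)"
      using vertex_decomposable_imp_shellable[OF _ sc] vd unfolding Sigma_complex_eq_dual by blast
    \<comment> \<open>Purity supplies the common facet size for the Cohen-Macaulay argument.\<close>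
    have "\<forall>F\<in>facets (dual_complex (fst G) (Con r G)). card F = card (fst G) - r"
      using uniform unfolding facets_dual_complex[OF uniform] by (auto simp: nsets_iff card_Diff_subset)
    then have cm: "cohen_macaulay TYPE('k) (Sigma_complex r G)"
      using vertex_decomposable_imp_cohen_macaulay[OF _ sc] vd unfolding Sigma_complex_eq_dual by blast
    have cc: "cochordal_clutter (fst G) r (Con r G)" by (rule vertex_splittable_imp_cochordal[OF vs fin uniform])
    \<comment> \<open>A gap would contradict the co-chordality just established.\<close>
    then have "gap_free r G" using gf gap_imp_not_cochordal[OF _ uniform assms(2)] by blast
    then show ?thesis using vd sh cm cc True by simp
  next
    case False
    then obtain A B where g: "gap (Con r G) A B" using ladder_gap[of r n] assms(2) unfolding Con by auto
    have "\<not> shellable (Sigma_complex r G)"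
      unfolding Sigma_complex_eq_dual by (rule gap_imp_not_shellable[OF g uniform assms(2) fin])
    moreover have "\<not> vertex_decomposable (Sigma_complex r G)"
      using vertex_decomposable_imp_shellable[OF _ sc] calculation unfolding Sigma_complex_eq_dual by blast
    moreover have "\<not> cohen_macaulay TYPE('k) (Sigma_complex r G)"
      unfolding Sigma_complex_eq_dual by (rule gap_imp_not_cohen_macaulay[OF g uniform assms(2)])
    moreover have "\<not> gap_free r G" using gf g by blast
    moreover have "\<not> cochordal_clutter (fst G) r (Con r G)"
      by (rule gap_imp_not_cochordal[OF g uniform assms(2)])
    ultimately show ?thesis using False by simp
  qed
qed

end
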